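(* Let $\mathcal{A}$ and $\mathcal{B}$ be linearly ordered $\mathbb{Z}_2$-graded sets, each at most countable. There exists a bijection $$\mathcal{M}_{\mathcal{A},\mathbb{N}}\times \mathcal{M}_{\mathcal{B},\mathbb{N}^\vee}\longrightarrow \mathcal{M}_{\mathcal{B},\mathbb{N}^\vee}\times \mathcal{M}_{\mathcal{A},\mathbb{N}}\times \mathcal{M}_{\mathcal{A},\mathcal{B}},\qquad (X,Y)\mapsto (Y',X',Z),$$ such that for all $(X,Y)$: (1) $\mathrm{wt}_{\mathcal{A}}(X)=\mathrm{wt}_{\mathcal{A}}(X')+\mathrm{wt}_{\mathcal{A}}(Z)$ and $\mathrm{wt}_{\mathcal{B}}(Y)=\mathrm{wt}_{\mathcal{B}}(Y')+\mathrm{wt}_{\mathcal{B}}(Z)$; (2) $u_Xu_Y=t^{|Z|}u_{Y'}u_{X'}$ in $\mathscr{U}(t)$, where $|Z|=\sum_{i,j}z_{ij}$ for $Z=(z_{ij})$.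
   Context: A $\mathbb{Z}_2$-graded set is a set $\mathcal{A}=\mathcal{A}_0\sqcup\mathcal{A}_1$; $|a|=\epsilon$ for $a\in\mathcal{A}_\epsilon$. $\mathbb{N}=\{1<2<\cdots\}$ and $\mathbb{N}^\vee=\{i^\vee : i\in\mathbb{N}\}$ with $i^\vee<j^\vee$ iff $i>j$; all elements of $\mathbb{N}$ and $\mathbb{N}^\vee$ have degree $0$. For linearly ordered $\mathbb{Z}_2$-graded sets $\mathcal{C},\mathcal{D}$, $\mathcal{M}_{\mathcal{C},\mathcal{D}}$ is the set of $\mathcal{C}\times\mathcal{D}$ matrices $A=(a_{ij})$ with entries in $\mathbb{Z}_{\ge0}$ such that $\sum_{i,j}a_{ij}<\infty$ and $a_{ij}\le 1$ whenever $|i|\ne|j|$. Put $\mathrm{wt}_{\mathcal{C}}(A)=\sum_{i,j}a_{ij}\epsilon_i$ and $\mathrm{wt}_{\mathcal{D}}(A)=\sum_{i,j}a_{ij}\epsilon_j$, in the free abelian groups with bases $\{\epsilon_i\}_{i\in\mathcal{C}}$ and $\{\epsilon_j\}_{j\in\mathcal{D}}$ respectively. Order $\mathcal{C}\times\mathcal{D}$ linearly by: $(i,j)<(k,l)$ iff $i<k$, or ($i=k$, $|i|=0$ and $j>l$), or ($i=k$, $|i|=1$ and $j<l$). For $A\in\mathcal{M}_{\mathcal{C},\mathcal{D}}$, list the pairs $(i,j)$, each repeated $a_{ij}$ times, in weakly increasing order as $(i_1,j_1)\le\cdots\le(i_r,j_r)$. If $\mathcal{D}=\mathbb{N}$ or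 $\mathbb{N}^\vee$, put $u_A=u_{j_1}u_{j_2}\cdots u_{j_r}$ (with $u_A=1$ for $A=0$). $\mathscr{U}(t)$ is the associative unital $\mathbb{Q}[t,t^{-1}]$-algebra ($t$ an indeterminate) generated by $u_i,u_{i^\vee}$ ($i\in\mathbb{N}$) with relations: $u_iu_ju_k=u_iu_ku_j$ and $u_{k^\vee}u_{j^\vee}u_{i^\vee}=u_{j^\vee}u_{k^\vee}u_{i^\vee}$ for $j\le i<k$; $u_iu_ju_k=u_ju_iu_k$ and $u_{k^\vee}u_{j^\vee}u_{i^\vee}=u_{k^\vee}u_{i^\vee}u_{j^\vee}$ for $j<k\le i$; $u_{i+1}u_{(i+1)^\vee}=u_{i^\vee}u_i$ for $i\ge1$; $u_1u_{1^\vee}=t$; $u_iu_{j^\vee}=u_{j^\vee}u_i$ for $i\ne j$. *)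

theory Defs
  imports
    Complex_Main
    "HOL-Library.Countable_Set"
    "HOL-Library.Dual_Ordered_Lattice"
    "HOL-Library.Multiset"
    "HOL-Library.Poly_Mapping"
    "HOL-Library.Z2"
begin

text \<open>
  A linearly ordered \<open>\<int>\<^sub>2\<close>-graded set is a subset \<open>C\<close> of a linearly ordered type
  (with the induced order) together with a degree function into the two-element type
  \<^typ>\<open>bit\<close>. The ordered set \<open>\<nat> = {1 < 2 < \<dots>}\<close> is \<^term>\<open>UNIV :: num set\<close>, where
  \<^typ>\<open>num\<close> is the type of strictly positive integers. The set \<open>\<nat>\<^sup>\<or>\<close> is
  \<^term>\<open>UNIV :: num dual set\<close>, with \<^term>\<open>dual i\<close> in the role of \<open>i\<^sup>\<or>\<close>. Both are
  graded by the constant function \<^term>\<open>(\<lambda>_. 0) :: 'a \<Rightarrow> bit\<close>.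
\<close>

instance dual :: (linorder) linorder
  by standard (simp add: dual_less_eq_iff linear)

subsection \<open>Matrices\<close>

text \<open>
  A \<open>C \<times> D\<close> matrix is represented by a function on the whole types that vanishes outside
  \<open>C \<times> D\<close>. For entries in the natural numbers, a finite sum of entries means finite support.
\<close>

definition supp :: "('c \<Rightarrow> 'd \<Rightarrow> nat) \<Rightarrow> ('c \<times> 'd) set"
  where "supp M = {(i, j). M i j \<noteq> 0}"

definition mats :: "'c set \<Rightarrow> ('c \<Rightarrow> bit) \<Rightarrow> 'd set \<Rightarrow> ('d \<Rightarrow> bit) \<Rightarrow> ('c \<Rightarrow> 'd \<Rightarrow> nat) set"
  where "mats C dC D dD =
    {M. supp M \<subseteq> C \<times> D \<and> finite (supp M) \<and>
        (\<forall>i\<in>C. \<forall>j\<in>D. dC i \<noteq> dD j \<longrightarrow> M i j \<le> 1)}"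

definition wt_row :: "('c \<Rightarrow> 'd \<Rightarrow> nat) \<Rightarrow> 'c \<Rightarrow>\<^sub>0 int"
  where "wt_row M = (\<Sum>(i, j)\<in>supp M. frag_cmul (int (M i j)) (frag_of i))"

definition wt_col :: "('c \<Rightarrow> 'd \<Rightarrow> nat) \<Rightarrow> 'd \<Rightarrow>\<^sub>0 int"
  where "wt_col M = (\<Sum>(i, j)\<in>supp M. frag_cmul (int (M i j)) (frag_of j))"

definition msize :: "('c \<Rightarrow> 'd \<Rightarrow> nat) \<Rightarrow> nat"
  where "msize M = (\<Sum>(i, j)\<in>supp M. M i j)"

subsection \<open>The listing of a matrix\<close>

fun pair_less :: "('c::linorder \<Rightarrow> bit) \<Rightarrow> 'c \<times> 'd::linorder \<Rightarrow> 'c \<times> 'd \<Rightarrow> bool"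
  where "pair_less dC (i, j) (k, l) \<longleftrightarrow>
    i < k \<or> (i = k \<and> dC i = 0 \<and> j > l) \<or> (i = k \<and> dC i = 1 \<and> j < l)"

definition pair_le :: "('c::linorder \<Rightarrow> bit) \<Rightarrow> 'c \<times> 'd::linorder \<Rightarrow> 'c \<times> 'd \<Rightarrow> bool"
  where "pair_le dC p q \<longleftrightarrow> pair_less dC p q \<or> p = q"

definition listing :: "('c::linorder \<Rightarrow> bit) \<Rightarrow> ('c \<Rightarrow> 'd::linorder \<Rightarrow> nat) \<Rightarrow> ('c \<times> 'd) list"
  where "listing dC M =
    (THE ps. sorted_wrt (pair_le dC) ps \<and> (\<forall>i j. count_list ps (i, j) = M i j))"

lemma pair_linorder: "class.linorder (pair_le dC) (pair_less dC)"
proof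
  fix p q r :: "'a \<times> 'b"
  have split: "dC i = 0 \<or> dC i = 1" for i by (cases "dC i") auto
  show "pair_less dC p q = (pair_le dC p q \<and> \<not> pair_le dC q p)"
    by (cases p; cases q) (auto simp: pair_le_def)
  show "pair_le dC p p" by (simp add: pair_le_def)
  show "pair_le dC p r" if "pair_le dC p q" "pair_le dC q r"
    using that by (cases p; cases q; cases r) (simp add: pair_le_def, elim disjE conjE; force)
  show "p = q" if "pair_le dC p q" "pair_le dC q p"
    using that by (cases p; cases q) (auto simp: pair_le_def)
  show "pair_le dC p q \<or> pair_le dC q p"
    using split[of "fst p"] by (cases p; cases q) (auto simp: pair_le_def neq_iff)
qed

lemma listing_ex1:
  fixes dC :: "'c::linorder \<Rightarrow> bit" and M :: "'c \<Rightarrow> 'd::linorder \<Rightarrow> nat"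
  assumes "finite (supp M)"
  shows "\<exists>!ps. sorted_wrt (pair_le dC) ps \<and> (\<forall>i j. count_list ps (i, j) = M i j)"
proof -
  interpret L: linorder "pair_le dC :: 'c \<times> 'd \<Rightarrow> _" "pair_less dC"
    by (rule pair_linorder)
  define W where "W = Abs_multiset (\<lambda>(i, j). M i j)"
  have "{p. 0 < (case p of (i, j) \<Rightarrow> M i j)} = supp M"
    by (auto simp: supp_def)
  then have W: "count W = (\<lambda>(i, j). M i j)"
    using assms unfolding W_def by (intro count_Abs_multiset) simp
  have iff: "(\<forall>i j. count_list ps (i, j) = M i j) \<longleftrightarrow> mset ps = W" for ps
    by (auto simp: multiset_eq_iff W count_mset)
  obtain xs where xs: "mset xs = W" by (metis ex_mset)
  show ?thesis
    unfolding iff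
  proof (rule ex1I)
    show "sorted_wrt (pair_le dC) (L.sort xs) \<and> mset (L.sort xs) = W"
      by (simp add: xs)
  next
    fix ps assume "sorted_wrt (pair_le dC) ps \<and> mset ps = W"
    then show "ps = L.sort xs"
      by (metis L.properties_for_sort xs)
  qed
qed

subsection \<open>The free associative algebra\<close>

text \<open>
  The group ring of \<open>\<int>\<close> over \<open>\<rat>\<close> is \<open>\<rat>[t, t\<^sup>-\<^sup>1]\<close>.
\<close>

type_synonym laurent = "int \<Rightarrow>\<^sub>0 rat"

definition tvar :: laurent
  where "tvar = Poly_Mapping.single 1 1"

text \<open>
  The free associative algebra is the monoid ring of the free monoid of words, so lists are made
  an additive monoid under concatenation.
\<close>

instantiation list :: (type) monoid_add
begin
definition zero_list :: "'a list" where "zero_list = []"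
definition plus_list :: "'a list \<Rightarrow> 'a list \<Rightarrow> 'a list" where "plus_list = (@)"
instance by standard (simp_all add: zero_list_def plus_list_def)
end

type_synonym 'g free_alg = "'g list \<Rightarrow>\<^sub>0 laurent"

definition scal :: "laurent \<Rightarrow> 'g free_alg"
  where "scal c = Poly_Mapping.single [] c"

definition gen :: "'g \<Rightarrow> 'g free_alg"
  where "gen g = Poly_Mapping.single [g] 1"

lemma scal_add: "scal (c + d) = scal c + scal d"
  by (simp add: scal_def single_add)

lemma scal_mult: "scal (c * d) = scal c * scal d"
  by (simp add: scal_def mult_single plus_list_def)

lemma scal_one: "scal 1 = 1"
  by (simp add: scal_def flip: zero_list_def)

lemma free_alg_induct [case_names single sum]:
  fixes x :: "'g free_alg"
  assumes single: "\<And>w c. P (Poly_Mapping.single w c)"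
    and sum: "\<And>x y. P x \<Longrightarrow> P y \<Longrightarrow> P (x + y)"
  shows "P x"
proof (induction x rule: Poly_Mapping.update_induct)
  case const
  show ?case using single[of undefined 0] by simp
next
  case (update x w c)
  have "Poly_Mapping.update w c x = x + Poly_Mapping.single w c"
    using update(1)
    by (intro poly_mapping_eqI)
      (auto simp: lookup_update lookup_add lookup_single in_keys_iff)
  with update(3) show ?case by (simp add: single sum)
qed

lemma scal_central: "scal c * x = x * scal c"
proof (induction x rule: free_alg_induct)
  case (single w d)
  then show ?case
    by (simp add: scal_def mult_single plus_list_def mult.commute)
next
  case (sum x y)
  then show ?case by (simp add: distrib_left distrib_right)
qed

subsection \<open>The algebra \<open>\<U>(t)\<close>\<close>

abbreviation gu :: "num \<Rightarrow> (num + num dual) free_alg"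
  where "gu i \<equiv> gen (Inl i)"

abbreviation gv :: "num \<Rightarrow> (num + num dual) free_alg"
  where "gv i \<equiv> gen (Inr (dual i))"

inductive U_rel :: "(num + num dual) free_alg \<Rightarrow> (num + num dual) free_alg \<Rightarrow> bool"
  where
    "j \<le> i \<Longrightarrow> i < k \<Longrightarrow> U_rel (gu i * gu j * gu k) (gu i * gu k * gu j)"
  | "j \<le> i \<Longrightarrow> i < k \<Longrightarrow> U_rel (gv k * gv j * gv i) (gv j * gv k * gv i)"
  | "j < k \<Longrightarrow> k \<le> i \<Longrightarrow> U_rel (gu i * gu j * gu k) (gu j * gu i * gu k)"
  | "j < k \<Longrightarrow> k \<le> i \<Longrightarrow> U_rel (gv k * gv j * gv i) (gv k * gv i * gv j)"
  | "U_rel (gu (i + num.One) * gv (i + num.One)) (gv i * gu i)"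
  | "U_rel (gu num.One * gv num.One) (scal tvar)"
  | "i \<noteq> j \<Longrightarrow> U_rel (gu i * gv j) (gv j * gu i)"

text \<open>
  The least ring congruence containing the relations. It is compatible with scalars because the
  scalars are elements of the free algebra.
\<close>

inductive U_cong :: "(num + num dual) free_alg \<Rightarrow> (num + num dual) free_alg \<Rightarrow> bool"
  where
    base: "U_rel x y \<Longrightarrow> U_cong x y"
  | refl: "U_cong x x"
  | sym: "U_cong x y \<Longrightarrow> U_cong y x"
  | trans: "U_cong x y \<Longrightarrow> U_cong y z \<Longrightarrow> U_cong x z"
  | add: "U_cong x x' \<Longrightarrow> U_cong y y' \<Longrightarrow> U_cong (x + y) (x' + y')"
  | mult: "U_cong x x' \<Longrightarrow> U_cong y y' \<Longrightarrow> U_cong (x * y) (x' * y')"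

lemma U_cong_uminus: "U_cong x y \<Longrightarrow> U_cong (- x) (- y)"
  using U_cong.mult[OF U_cong.refl[of "- 1"]] by force

text \<open>
  The congruence is proper, because \<open>u\<^sub>i \<mapsto> t\<close>, \<open>u\<^bsub>i\<^sup>\<or>\<^esub> \<mapsto> 1\<close> defines a homomorphism
  to the Laurent polynomials.
\<close>

definition ev_word :: "('a + 'b) list \<Rightarrow> laurent"
  where "ev_word w = prod_list (map (case_sum (\<lambda>_. tvar) (\<lambda>_. 1)) w)"

definition ev :: "('a + 'b) free_alg \<Rightarrow> laurent"
  where "ev x = (\<Sum>w\<in>Poly_Mapping.keys x. Poly_Mapping.lookup x w * ev_word w)"

lemma ev_superset:
  assumes "finite S" "Poly_Mapping.keys x \<subseteq> S"
  shows "ev x = (\<Sum>w\<in>S. Poly_Mapping.lookup x w * ev_word w)"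
  unfolding ev_def using assms
  by (intro sum.mono_neutral_left) (auto simp: not_in_keys_iff_lookup_eq_zero)

lemma ev_add: "ev (x + y) = ev x + ev y"
proof -
  let ?S = "Poly_Mapping.keys x \<union> Poly_Mapping.keys y"
  have "ev (x + y) = (\<Sum>w\<in>?S. Poly_Mapping.lookup (x + y) w * ev_word w)"
    by (intro ev_superset Poly_Mapping.keys_add) simp
  also have "\<dots> = ev x + ev y"
    by (simp add: ev_superset[of ?S] lookup_add distrib_right sum.distrib)
  finally show ?thesis .
qed

lemma ev_single: "ev (Poly_Mapping.single w c) = c * ev_word w"
  by (subst ev_superset[of "{w}"]) auto

lemma ev_mult: "ev (x * y) = ev x * ev y"
proof (induction x rule: free_alg_induct)
  case (single v c)
  show ?case
  proof (induction y rule: free_alg_induct)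
    case (single w d)
    show ?case by (simp add: mult_single ev_single plus_list_def ev_word_def)
  next
    case (sum y z)
    then show ?case by (simp add: distrib_left ev_add)
  qed
next
  case (sum x z)
  then show ?case by (simp add: distrib_right ev_add)
qed

lemma ev_gen: "ev (gu i) = tvar" "ev (gv i) = 1" "ev (scal c) = c"
  by (simp_all add: gen_def scal_def ev_single ev_word_def)

lemma U_cong_ev: "U_cong x y \<Longrightarrow> ev x = ev y"
  by (induction rule: U_cong.induct)
    (auto elim!: U_rel.cases simp: ev_mult ev_add ev_gen)

lemma U_cong_nontrivial: "\<not> U_cong 0 1"
proof
  assume "U_cong 0 1"
  then have "ev (0 :: (num + num dual) free_alg) = ev (scal 1 :: (num + num dual) free_alg)"
    by (simp add: U_cong_ev scal_one)
  then show False by (simp add: ev_gen) (simp add: ev_def)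
qed

quotient_type U_alg = "(num + num dual) free_alg" / U_cong
  by (intro equivpI reflpI sympI transpI) (blast intro: U_cong.intros)+

instantiation U_alg :: ring_1
begin

lift_definition zero_U_alg :: U_alg is 0 .
lift_definition one_U_alg :: U_alg is 1 .
lift_definition plus_U_alg :: "U_alg \<Rightarrow> U_alg \<Rightarrow> U_alg" is "(+)" by (rule U_cong.add)
lift_definition times_U_alg :: "U_alg \<Rightarrow> U_alg \<Rightarrow> U_alg" is "(*)" by (rule U_cong.mult)
lift_definition uminus_U_alg :: "U_alg \<Rightarrow> U_alg" is uminus by (rule U_cong_uminus)
lift_definition minus_U_alg :: "U_alg \<Rightarrow> U_alg \<Rightarrow> U_alg" is "(-)"
  by (simp only: diff_conv_add_uminus U_cong.add U_cong_uminus)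

instance
proof
  fix a b c :: U_alg
  show "a * b * c = a * (b * c)" by transfer (simp add: mult.assoc U_cong.refl)
  show "1 * a = a" "a * 1 = a" by (transfer, simp add: U_cong.refl)+
  show "a + b + c = a + (b + c)" by transfer (simp add: add.assoc U_cong.refl)
  show "a + b = b + a" by transfer (simp add: add.commute U_cong.refl)
  show "0 + a = a" "- a + a = 0" by (transfer, simp add: U_cong.refl)+
  show "a - b = a + - b" by transfer (simp add: U_cong.refl)
  show "(a + b) * c = a * c + b * c" by transfer (simp add: distrib_right U_cong.refl)
  show "a * (b + c) = a * b + a * c" by transfer (simp add: distrib_left U_cong.refl)
  show "(0::U_alg) \<noteq> 1" by transfer (rule U_cong_nontrivial)
qed

end

lift_definition scaleU :: "laurent \<Rightarrow> U_alg \<Rightarrow> U_alg" is "\<lambda>c x. scal c * x"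
  by (intro U_cong.mult U_cong.refl)

lemma module_scaleU: "module scaleU"
proof
  fix c d :: laurent and x y :: U_alg
  show "scaleU c (x + y) = scaleU c x + scaleU c y"
    by transfer (simp only: distrib_left U_cong.refl)
  show "scaleU (c + d) x = scaleU c x + scaleU d x"
    by transfer (simp only: scal_add distrib_right U_cong.refl)
  show "scaleU c (scaleU d x) = scaleU (c * d) x"
    by transfer (simp only: scal_mult mult.assoc U_cong.refl)
  show "scaleU 1 x = x"
    by transfer (simp only: scal_one mult_1_left U_cong.refl)
qed

lemma scaleU_mult_left: "scaleU c x * y = scaleU c (x * y)"
  by transfer (simp only: mult.assoc U_cong.refl)

lemma scaleU_mult_right: "x * scaleU c y = scaleU c (x * y)"
proof transfer
  fix x y :: "(num + num dual) free_alg" and c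
  have "x * (scal c * y) = scal c * (x * y)"
    by (simp only: mult.assoc [symmetric] scal_central [of c x])
  then show "U_cong (x * (scal c * y)) (scal c * (x * y))"
    by (simp only: U_cong.refl)
qed

lift_definition u_gen :: "num \<Rightarrow> U_alg" is "\<lambda>i. gen (Inl i)" .

lift_definition uv_gen :: "num dual \<Rightarrow> U_alg" is "\<lambda>j. gen (Inr j)" .

definition u_mat ::
  "('d \<Rightarrow> U_alg) \<Rightarrow> ('c::linorder \<Rightarrow> bit) \<Rightarrow> ('c \<Rightarrow> 'd::linorder \<Rightarrow> nat) \<Rightarrow> U_alg"
  where "u_mat g dC M = prod_list (map (\<lambda>(i, j). g j) (listing dC M))"

end

theory Submission
  imports Defs
begin

text \<open>
  Write \<open>v\<^sub>i\<close> for the generator dual to \<open>u\<^sub>i\<close>, and put \<open>v\<^sub>0 = t\<close> and \<open>u\<^sub>0 = 1\<close>. A letter \<open>v\<^sub>j\<close>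
  that moves to the left through a word in the \<open>u\<^sub>i\<close> then obeys a deterministic rule: it commutes with
  \<open>u\<^sub>i\<close> for \<open>i \<noteq> j\<close>, and \<open>u\<^bsub>n+1\<^esub> v\<^bsub>n+1\<^esub> = v\<^sub>n u\<^sub>n\<close>. Moving every letter of \<open>u\<^sub>Y\<close> through \<open>u\<^sub>X\<close> in
  this way rewrites \<open>u\<^sub>X u\<^sub>Y\<close> as a product of letters \<open>v\<close>, some of them equal to \<open>v\<^sub>0 = t\<close>, and of
  letters \<open>u\<close>. The point is that the result has again the shape \<open>t\<^bsup>|Z|\<^esup> u\<^bsub>Y'\<^esub> u\<^bsub>X'\<^esub>\<close>, and that no
  information is lost.

  For one row \<open>x\<close> of \<open>X\<close> and one letter this is explicit. The word of an even row is weakly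
  decreasing, and \<open>v\<^sub>j\<close> becomes \<open>v\<^bsub>j-1\<^esub>\<close> if \<open>j\<close> occurs in it and stays \<open>v\<^sub>j\<close> otherwise. The word of an
  odd row is strictly increasing, and \<open>v\<^sub>j\<close> becomes \<open>v\<^sub>k\<close> for the largest \<open>k \<le> j\<close> that does not occur
  in it. In both cases \<open>j\<close> is replaced by the new index in the row (an index \<open>0\<close> being dropped), and
  the step can be undone. Moreover the order of two successive letters determines, and is determined
  by, the order of the letters that come out (\<open>push_push\<close> in the locale \<open>letter_exchange\<close>, established
  by the interpretations \<open>even_row\<close> and \<open>odd_row\<close>). So the words of one row of \<open>Y\<close> correspond
  to those words which consist of the word of such a row and some number \<open>z\<close> of letters \<open>v\<^sub>0\<close>, where
  \<open>z\<close> is arbitrary if the two rows have the same degree, and \<open>z \<le> 1\<close> if not. This \<open>z\<close> is the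
  entry of \<open>Z\<close> for this pair of rows, and one obtains the theorem for two single rows
  (\<open>word_exchange\<close>).

  For finitely many rows the single exchanges are composed (\<open>exchange_mult_left\<close>,
  \<open>exchange_mult_right\<close>, \<open>exchange_finite\<close>): the last row of \<open>X\<close> passes all the rows of \<open>Y\<close>, then the
  last but one, and so on; the powers of \<open>t\<close> are central. Arbitrary index sets reduce to finite
  ones because the bijection preserves the weights, and the supports of the weights tell which
  finitely many rows are involved (\<open>fam_eq_glue\<close>, \<open>exchange_all\<close>).
\<close>

section \<open>Labelled families\<close>

text \<open>
  A family \<open>(I, f)\<close> of labels stands for the possibly infinite formal sum of the \<open>f i\<close>. The relation
  \<open>\<approx>\<close> is equality of such sums, witnessed by a bijection, and \<open>\<otimes>\<close> is their product. The required
  map \<open>\<Phi>\<close> is exactly a witness of one such equality between products, so that all composition of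
  bijections becomes calculation with \<open>\<approx>\<close>.
\<close>

type_synonym ('i, 'l) fam = "'i set \<times> ('i \<Rightarrow> 'l)"

definition fam_eq :: "('i, 'l) fam \<Rightarrow> ('j, 'l) fam \<Rightarrow> bool" (infix "\<approx>" 50)
  where "F \<approx> G \<longleftrightarrow> (\<exists>h. bij_betw h (fst F) (fst G) \<and> (\<forall>i\<in>fst F. snd G (h i) = snd F i))"

definition fam_mult :: "('i, 'l::times) fam \<Rightarrow> ('j, 'l) fam \<Rightarrow> ('i \<times> 'j, 'l) fam" (infixr "\<otimes>" 70)
  where "F \<otimes> G = (fst F \<times> fst G, \<lambda>(i, j). snd F i * snd G j)"

lemma fam_eqI:
  assumes "\<And>i. i \<in> I \<Longrightarrow> h i \<in> J \<and> k (h i) = i \<and> g (h i) = f i"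
    and "\<And>j. j \<in> J \<Longrightarrow> k j \<in> I \<and> h (k j) = j"
  shows "(I, f) \<approx> (J, g)"
  unfolding fam_eq_def fst_conv snd_conv
  using assms by (intro exI[of _ h] conjI bij_betw_byWitness[where f' = k]) auto

lemma fam_eq_refl: "F \<approx> F"
  unfolding fam_eq_def by (intro exI[of _ id]) auto

lemma fam_eq_sym:
  assumes "F \<approx> G"
  shows "G \<approx> F"
proof -
  obtain h where h: "bij_betw h (fst F) (fst G)" "\<forall>i\<in>fst F. snd G (h i) = snd F i"
    using assms unfolding fam_eq_def by blast
  show ?thesis
    unfolding fam_eq_def
    using h bij_betw_inv_into[OF h(1)]
    by (intro exI[of _ "inv_into (fst F) h"])
      (metis bij_betwE bij_betw_inv_into_right)
qed

lemma fam_eq_trans [trans]: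
  assumes "F \<approx> G" "G \<approx> H"
  shows "F \<approx> H"
proof -
  obtain h k where "bij_betw h (fst F) (fst G)" "\<forall>i\<in>fst F. snd G (h i) = snd F i"
    "bij_betw k (fst G) (fst H)" "\<forall>i\<in>fst G. snd H (k i) = snd G i"
    using assms unfolding fam_eq_def by blast
  then show ?thesis
    unfolding fam_eq_def
    by (intro exI[of _ "k \<circ> h"]) (auto intro: bij_betw_trans dest: bij_betwE)
qed

lemma fam_mult_cong:
  assumes "F \<approx> F'" "G \<approx> G'"
  shows "F \<otimes> G \<approx> F' \<otimes> G'"
proof -
  obtain h k where "bij_betw h (fst F) (fst F')" "\<forall>i\<in>fst F. snd F' (h i) = snd F i"
    "bij_betw k (fst G) (fst G')" "\<forall>i\<in>fst G. snd G' (k i) = snd G i"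
    using assms unfolding fam_eq_def by blast
  then show ?thesis
    unfolding fam_eq_def fam_mult_def
    by (intro exI[of _ "map_prod h k"]) (auto intro: bij_betw_map_prod)
qed

lemmas fam_mult_cong1 = fam_mult_cong[OF _ fam_eq_refl]
lemmas fam_mult_cong2 = fam_mult_cong[OF fam_eq_refl]

lemma fam_mult_assoc:
  fixes F :: "('i, 'l::semigroup_mult) fam"
  shows "(F \<otimes> G) \<otimes> H \<approx> F \<otimes> (G \<otimes> H)"
  unfolding fam_mult_def
  by (rule fam_eqI[where h = "\<lambda>((i, j), k). (i, (j, k))" and k = "\<lambda>(i, (j, k)). ((i, j), k)"])
    (auto simp: mult.assoc)

lemmas fam_mult_assoc' = fam_mult_assoc[THEN fam_eq_sym]

definition fam_central :: "('i, 'l::times) fam \<Rightarrow> bool"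
  where "fam_central Z \<longleftrightarrow> (\<forall>i\<in>fst Z. \<forall>l. snd Z i * l = l * snd Z i)"

lemma fam_mult_commute:
  assumes "fam_central Z"
  shows "Z \<otimes> F \<approx> F \<otimes> Z"
  unfolding fam_mult_def
  by (rule fam_eqI[where h = prod.swap and k = prod.swap])
    (use assms in \<open>auto simp: fam_central_def\<close>)

text \<open>
  If \<open>R1\<close> and \<open>R2\<close> can both be moved past \<open>C\<close> at the cost of central factors, so can \<open>R1 \<otimes> R2\<close>:
  first \<open>R2\<close> moves, then \<open>R1\<close>, and the central factors are collected on the right.
\<close>

lemma exchange_mult_left:
  fixes R :: "('i, 'l::semigroup_mult) fam"
  assumes R: "R \<approx> R1 \<otimes> R2" and Z: "Z \<approx> Z1 \<otimes> Z2" and "fam_central Z1"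
    and ex1: "R1 \<otimes> C \<approx> C \<otimes> R1 \<otimes> Z1" and ex2: "R2 \<otimes> C \<approx> C \<otimes> R2 \<otimes> Z2"
  shows "R \<otimes> C \<approx> C \<otimes> R \<otimes> Z"
proof -
  have "(R1 \<otimes> Z1) \<otimes> (R2 \<otimes> Z2) \<approx> R1 \<otimes> (Z1 \<otimes> (R2 \<otimes> Z2))"
    by (rule fam_mult_assoc)
  also have "\<dots> \<approx> R1 \<otimes> ((Z1 \<otimes> R2) \<otimes> Z2)"
    by (intro fam_mult_cong2 fam_mult_assoc')
  also have "\<dots> \<approx> R1 \<otimes> ((R2 \<otimes> Z1) \<otimes> Z2)"
    by (intro fam_mult_cong2 fam_mult_cong1 fam_mult_commute assms)
  also have "\<dots> \<approx> R1 \<otimes> (R2 \<otimes> (Z1 \<otimes> Z2))"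
    by (intro fam_mult_cong2 fam_mult_assoc)
  also have "\<dots> \<approx> (R1 \<otimes> R2) \<otimes> (Z1 \<otimes> Z2)"
    by (rule fam_mult_assoc')
  also have "\<dots> \<approx> R \<otimes> Z"
    by (intro fam_mult_cong R[THEN fam_eq_sym] Z[THEN fam_eq_sym])
  finally have regroup: "(R1 \<otimes> Z1) \<otimes> (R2 \<otimes> Z2) \<approx> R \<otimes> Z" .
  have "R \<otimes> C \<approx> (R1 \<otimes> R2) \<otimes> C"
    by (intro fam_mult_cong1 R)
  also have "\<dots> \<approx> R1 \<otimes> (R2 \<otimes> C)"
    by (rule fam_mult_assoc)
  also have "\<dots> \<approx> R1 \<otimes> (C \<otimes> (R2 \<otimes> Z2))"
    by (intro fam_mult_cong2 ex2)
  also have "\<dots> \<approx> (R1 \<otimes> C) \<otimes> (R2 \<otimes> Z2)"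
    by (rule fam_mult_assoc')
  also have "\<dots> \<approx> (C \<otimes> (R1 \<otimes> Z1)) \<otimes> (R2 \<otimes> Z2)"
    by (intro fam_mult_cong1 ex1)
  also have "\<dots> \<approx> C \<otimes> ((R1 \<otimes> Z1) \<otimes> (R2 \<otimes> Z2))"
    by (rule fam_mult_assoc)
  also have "\<dots> \<approx> C \<otimes> (R \<otimes> Z)"
    by (intro fam_mult_cong2 regroup)
  finally show ?thesis .
qed

lemma exchange_mult_right:
  fixes C :: "('i, 'l::semigroup_mult) fam"
  assumes C: "C \<approx> C1 \<otimes> C2" and Z: "Z \<approx> Z1 \<otimes> Z2" and "fam_central Z1"
    and ex1: "R \<otimes> C1 \<approx> C1 \<otimes> R \<otimes> Z1" and ex2: "R \<otimes> C2 \<approx> C2 \<otimes> R \<otimes> Z2"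
  shows "R \<otimes> C \<approx> C \<otimes> R \<otimes> Z"
proof -
  have "(R \<otimes> Z1) \<otimes> C2 \<approx> R \<otimes> (Z1 \<otimes> C2)"
    by (rule fam_mult_assoc)
  also have "\<dots> \<approx> R \<otimes> (C2 \<otimes> Z1)"
    by (intro fam_mult_cong2 fam_mult_commute assms)
  also have "\<dots> \<approx> (R \<otimes> C2) \<otimes> Z1"
    by (rule fam_mult_assoc')
  also have "\<dots> \<approx> (C2 \<otimes> (R \<otimes> Z2)) \<otimes> Z1"
    by (intro fam_mult_cong1 ex2)
  also have "\<dots> \<approx> C2 \<otimes> ((R \<otimes> Z2) \<otimes> Z1)"
    by (rule fam_mult_assoc)
  also have "\<dots> \<approx> C2 \<otimes> (R \<otimes> (Z2 \<otimes> Z1))"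
    by (intro fam_mult_cong2 fam_mult_assoc)
  also have "\<dots> \<approx> C2 \<otimes> (R \<otimes> (Z1 \<otimes> Z2))"
    by (intro fam_mult_cong2 fam_mult_commute[THEN fam_eq_sym] assms)
  also have "\<dots> \<approx> C2 \<otimes> (R \<otimes> Z)"
    by (intro fam_mult_cong2 Z[THEN fam_eq_sym])
  finally have second: "(R \<otimes> Z1) \<otimes> C2 \<approx> C2 \<otimes> (R \<otimes> Z)" .
  have "R \<otimes> C \<approx> R \<otimes> (C1 \<otimes> C2)"
    by (intro fam_mult_cong2 C)
  also have "\<dots> \<approx> (R \<otimes> C1) \<otimes> C2"
    by (rule fam_mult_assoc')
  also have "\<dots> \<approx> (C1 \<otimes> (R \<otimes> Z1)) \<otimes> C2"
    by (intro fam_mult_cong1 ex1)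
  also have "\<dots> \<approx> C1 \<otimes> ((R \<otimes> Z1) \<otimes> C2)"
    by (rule fam_mult_assoc)
  also have "\<dots> \<approx> C1 \<otimes> (C2 \<otimes> (R \<otimes> Z))"
    by (intro fam_mult_cong2 second)
  also have "\<dots> \<approx> (C1 \<otimes> C2) \<otimes> (R \<otimes> Z)"
    by (rule fam_mult_assoc')
  also have "\<dots> \<approx> C \<otimes> (R \<otimes> Z)"
    by (intro fam_mult_cong1 C[THEN fam_eq_sym])
  finally show ?thesis .
qed

text \<open>
  An invariant \<open>\<kappa>\<close> of the labels cuts both index sets into fibres, and a label-preserving bijection
  respects fibres. Hence bijections between larger pieces \<open>I' k\<close> and \<open>J' k\<close> restrict to bijections of
  the fibres over \<open>k\<close>, and these restrictions fit together without any compatibility between the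
  bijections for different \<open>k\<close>.
\<close>

lemma fam_eq_glue:
  fixes \<kappa> :: "'l \<Rightarrow> 'k"
  assumes local_eq: "\<And>k. k \<in> K \<Longrightarrow> (I' k, f) \<approx> (J' k, g)"
    and I: "\<And>i. i \<in> I \<Longrightarrow> \<kappa> (f i) \<in> K \<and> i \<in> I' (\<kappa> (f i))"
    and J: "\<And>j. j \<in> J \<Longrightarrow> \<kappa> (g j) \<in> K \<and> j \<in> J' (\<kappa> (g j))"
    and I': "\<And>k. k \<in> K \<Longrightarrow> I' k \<subseteq> I" and J': "\<And>k. k \<in> K \<Longrightarrow> J' k \<subseteq> J"
  shows "(I, f) \<approx> (J, g)"
proof -
  have "\<exists>h. bij_betw h (I' k) (J' k) \<and> (\<forall>i\<in>I' k. g (h i) = f i)" if "k \<in> K" for k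
    using local_eq[OF that] unfolding fam_eq_def by simp
  then obtain h where h: "bij_betw (h k) (I' k) (J' k)" "i \<in> I' k \<Longrightarrow> g (h k i) = f i"
    if "k \<in> K" for k i
    by metis
  define H where "H i = h (\<kappa> (f i)) i" for i
  define H' where "H' j = inv_into (I' (\<kappa> (g j))) (h (\<kappa> (g j))) j" for j
  show ?thesis
  proof (rule fam_eqI[where h = H and k = H'])
    fix i assume i: "i \<in> I"
    let ?k = "\<kappa> (f i)"
    have k: "?k \<in> K" "i \<in> I' ?k" using I[OF i] by auto
    have g: "g (H i) = f i" unfolding H_def using h(2) k by blast
    have "H i \<in> J" unfolding H_def using h(1)[OF k(1)] k J'[OF k(1)] by (auto dest: bij_betwE)
    moreover have "H' (H i) = i"
      unfolding H'_def g unfolding H_def using h(1)[OF k(1)] k by (simp add: bij_betw_inv_into_left)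
    ultimately show "H i \<in> J \<and> H' (H i) = i \<and> g (H i) = f i" using g by simp
  next
    fix j assume j: "j \<in> J"
    let ?k = "\<kappa> (g j)"
    have k: "?k \<in> K" "j \<in> J' ?k" using J[OF j] by auto
    have in_I': "H' j \<in> I' ?k" and inv: "h ?k (H' j) = j"
      unfolding H'_def using h(1)[OF k(1)] k
      by (auto simp: bij_betw_inv_into_right bij_betw_def inv_into_into)
    then have "f (H' j) = g j" using h(2)[OF k(1)] by metis
    then show "H' j \<in> I \<and> H (H' j) = j"
      unfolding H_def using in_I' inv I'[OF k(1)] by auto
  qed
qed

section \<open>Weights and algebra elements as labels\<close>

text \<open>
  A label records the two weights, which add up under multiplication, together with the element of
  the algebra. Equality of labels is therefore the conjunction of all the identities to be proved.
\<close>

datatype ('v, 'w) label = Label 'v 'w U_alg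

instantiation label :: (comm_monoid_add, comm_monoid_add) semigroup_mult
begin
fun times_label :: "('a, 'b) label \<Rightarrow> ('a, 'b) label \<Rightarrow> ('a, 'b) label"
  where "Label v w x * Label v' w' x' = Label (v + v') (w + w') (x * x')"
instance
proof
  fix a b c :: "('a, 'b) label"
  show "a * b * c = a * (b * c)"
    by (cases a; cases b; cases c) (simp add: add.assoc mult.assoc)
qed
end

section \<open>The generators and their exchange relation\<close>

text \<open>
  Letters are indexed by natural numbers, with the convention \<open>u\<^sub>0 = 1\<close> and \<open>v\<^sub>0 = t\<close> (where
  \<open>v\<^sub>i\<close> is the generator dual to \<open>u\<^sub>i\<close>). Then \<open>u\<^sub>1 v\<^sub>1 = t\<close> is the case \<open>n = 0\<close> of
  \<open>u\<^bsub>n+1\<^esub> v\<^bsub>n+1\<^esub> = v\<^sub>n u\<^sub>n\<close>, and a factor \<open>t\<close> is just a letter \<open>v\<^sub>0\<close>.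
\<close>

definition U :: "nat \<Rightarrow> U_alg"
  where "U n = (if n = 0 then 1 else u_gen (num_of_nat n))"

definition V :: "nat \<Rightarrow> U_alg"
  where "V n = (if n = 0 then scaleU tvar 1 else uv_gen (dual (num_of_nat n)))"

lemma V_0_central: "V 0 * x = x * V 0"
  by (simp add: V_def scaleU_mult_left scaleU_mult_right)

lemma num_of_nat_Suc_Suc: "num_of_nat (Suc (Suc n)) = num_of_nat (Suc n) + num.One"
  by (simp add: add_One)

lemma U_V_same: "U (Suc n) * V (Suc n) = V n * U n"
proof (cases n)
  case 0
  have "u_gen num.One * uv_gen (dual num.One) = scaleU tvar 1"
  proof transfer
    show "U_cong (gu num.One * gv num.One) (scal tvar * 1)"
      unfolding mult_1_right by (intro U_cong.base U_rel.intros)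
  qed
  with 0 show ?thesis by (simp add: U_def V_def)
next
  case (Suc m)
  have "u_gen (i + num.One) * uv_gen (dual (i + num.One)) = uv_gen (dual i) * u_gen i" for i
    by transfer (intro U_cong.base U_rel.intros)
  then show ?thesis
    unfolding Suc U_def V_def num_of_nat_Suc_Suc by simp
qed

lemma U_V_commute:
  assumes "i \<noteq> j"
  shows "U i * V j = V j * U i"
proof (cases "i = 0 \<or> j = 0")
  case True
  then show ?thesis using V_0_central by (auto simp: U_def)
next
  case False
  with assms have "num_of_nat i \<noteq> num_of_nat j"
    by (metis neq0_conv num_of_nat_inverse)
  moreover have "k \<noteq> l \<Longrightarrow> u_gen k * uv_gen (dual l) = uv_gen (dual l) * u_gen k" for k l
    by transfer (intro U_cong.base U_rel.intros)
  ultimately show ?thesis using False by (simp add: U_def V_def)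
qed

abbreviation Uw :: "nat list \<Rightarrow> U_alg" where "Uw xs \<equiv> prod_list (map U xs)"
abbreviation Vw :: "nat list \<Rightarrow> U_alg" where "Vw ys \<equiv> prod_list (map V ys)"

lemma Uw_V_commute: "j \<notin> set xs \<Longrightarrow> Uw xs * V j = V j * Uw xs"
proof (induction xs)
  case (Cons i xs)
  then have "U i * (Uw xs * V j) = (V j * U i) * Uw xs"
    using U_V_commute[of i j] by (simp flip: mult.assoc)
  then show ?case by (simp add: mult.assoc)
qed simp

text \<open>
  Each letter of a run of consecutive indices meets \<open>v\<close> with its own index, lowers that index and is
  itself lowered; so \<open>v\<close> drops below the run while the run shifts down by one.
\<close>

lemma Uw_interval_V: "a \<le> b \<Longrightarrow> Uw [Suc a..<Suc b] * V b = V a * Uw [a..<b]"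
proof (induction b rule: dec_induct)
  case (step b)
  (* The top letter of the run is the one next to V (Suc b). *)
  have "Uw [Suc a..<Suc (Suc b)] * V (Suc b) = Uw [Suc a..<Suc b] * (U (Suc b) * V (Suc b))"
    using step(1) by (simp add: mult.assoc)
  also have "\<dots> = (Uw [Suc a..<Suc b] * V b) * U b"
    by (simp only: U_V_same mult.assoc)
  also have "\<dots> = V a * Uw [a..<Suc b]"
    using step(1) by (simp only: step.IH) (simp add: mult.assoc)
  finally show ?case .
qed simp

section \<open>Pushing a word through a row\<close>

text \<open>
  Pushing \<open>v\<^sub>a\<close> and then \<open>v\<^sub>b\<close> through a row produces letters \<open>v\<^bsub>a'\<^esub>\<close> and \<open>v\<^bsub>b'\<^esub>\<close>. The order
  of \<open>a\<close> and \<open>b\<close> can be read off from \<open>a'\<close> and \<open>b'\<close>: it is the same, except that two letters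
  \<open>v\<^sub>0 = t\<close> come from a weakly increasing pair if the row is even, and from a strictly decreasing pair
  if it is odd. The parameter \<open>e\<close> says whether the row is even.
\<close>

definition pushed_le :: "bool \<Rightarrow> nat \<Rightarrow> nat \<Rightarrow> bool"
  where "pushed_le e a b \<longleftrightarrow> a \<le> b \<and> (b = 0 \<longrightarrow> e)"

text \<open>
  The common pattern of even and odd rows. The elements of \<open>St\<close> encode the rows, and pushing a letter of
  positive index through a row from right to left is a bijection between pairs of a row and a positive
  letter and pairs of a letter, possibly \<open>0\<close>, and a row, with inverse \<open>pull\<close>. Iterating it makes
  bijectivity for words automatic; what remains is to see which words come out, and for that the
  condition \<open>push_push\<close> on two consecutive letters suffices.
\<close>

locale letter_exchange =
  fixes e :: bool and St :: "'s set" and word :: "'s \<Rightarrow> U_alg" and len :: "'s \<Rightarrow> nat"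
    and push :: "'s \<Rightarrow> nat \<Rightarrow> nat \<times> 's" and pull :: "nat \<Rightarrow> 's \<Rightarrow> 's \<times> nat"
  assumes push: "\<lbrakk>s \<in> St; q \<noteq> 0; push s q = (q', s')\<rbrakk> \<Longrightarrow>
      s' \<in> St \<and> pull q' s' = (s, q) \<and> word s * V q = V q' * word s' \<and>
      len s = len s' + (if q' = 0 then 1 else 0)"
    and pull: "\<lbrakk>s' \<in> St; pull q' s' = (s, q)\<rbrakk> \<Longrightarrow> s \<in> St \<and> q \<noteq> 0 \<and> push s q = (q', s')"
    and push_push: "\<lbrakk>s \<in> St; a \<noteq> 0; b \<noteq> 0; push s a = (a', s'); push s' b = (b', s'')\<rbrakk> \<Longrightarrow>
      a \<le> b \<longleftrightarrow> pushed_le e a' b'"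
begin

fun push_word :: "'s \<Rightarrow> nat list \<Rightarrow> nat list \<times> 's"
  where
    "push_word s [] = ([], s)"
  | "push_word s (q # qs) =
      (let (q', s') = push s q; (qs', s'') = push_word s' qs in (q' # qs', s''))"

fun pull_word :: "nat list \<Rightarrow> 's \<Rightarrow> 's \<times> nat list"
  where
    "pull_word [] s = (s, [])"
  | "pull_word (q' # qs') s'' =
      (let (s', qs) = pull_word qs' s''; (s, q) = pull q' s' in (s, q # qs))"

lemma push_word:
  assumes "s \<in> St" "0 \<notin> set qs" "push_word s qs = (qs', s')"
  shows "s' \<in> St \<and> pull_word qs' s' = (s, qs) \<and> word s * Vw qs = Vw qs' * word s' \<and>
    len s = len s' + count_list qs' 0 \<and> length qs' = length qs"
  using assms
proof (induction qs arbitrary: s qs' s')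
  case (Cons q qs)
  obtain q1 s1 where 1: "push s q = (q1, s1)" by fastforce
  obtain qs1 s2 where 2: "push_word s1 qs = (qs1, s2)" by fastforce
  have q: "s1 \<in> St" "pull q1 s1 = (s, q)" "word s * V q = V q1 * word s1"
      "len s = len s1 + (if q1 = 0 then 1 else 0)"
    using push[OF _ _ 1] Cons.prems by auto
  have "word s * Vw (q # qs) = V q1 * (word s1 * Vw qs)"
    using q(3) by (simp flip: mult.assoc)
  then show ?case
    using Cons.IH[OF q(1) _ 2] Cons.prems 1 2 q by (auto simp: mult.assoc)
qed auto

lemma pull_word:
  assumes "s' \<in> St" "pull_word qs' s' = (s, qs)"
  shows "s \<in> St \<and> 0 \<notin> set qs \<and> push_word s qs = (qs', s')"
  using assms
proof (induction qs' arbitrary: s qs)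
  case (Cons q' qs')
  obtain s1 qs1 where 1: "pull_word qs' s' = (s1, qs1)" by fastforce
  obtain s2 q where 2: "pull q' s1 = (s2, q)" by fastforce
  show ?case
    using Cons.IH[OF Cons.prems(1) 1] pull[OF _ 2] Cons.prems 1 2 by auto
qed auto

text \<open>
  Being sorted is a condition on consecutive letters because both relations are transitive, whichever
  truth value \<open>c\<close> takes. Words of an even dual row are the case \<open>c = True\<close>, those of an odd one the
  case \<open>c = False\<close>.
\<close>

lemma push_word_sorted:
  assumes "s \<in> St" "0 \<notin> set qs" "push_word s qs = (qs', s')"
  shows "sorted_wrt (\<lambda>a b. (a \<le> b) = c) qs \<longleftrightarrow> sorted_wrt (\<lambda>a b. pushed_le e a b = c) qs'"
proof -
  have "successively (\<lambda>a b. (a \<le> b) = c) qs \<longleftrightarrow>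
      successively (\<lambda>a b. pushed_le e a b = c) qs'"
    using assms
  proof (induction qs arbitrary: s qs' s' rule: induct_list012)
    case (3 a b qs)
    obtain a' s1 where 1: "push s a = (a', s1)" by fastforce
    obtain b' s2 where 2: "push s1 b = (b', s2)" by fastforce
    obtain qs1 s3 where 3: "push_word s2 qs = (qs1, s3)" by fastforce
    have s1: "s1 \<in> St" using push[OF _ _ 1] "3.prems" by auto
    have "push_word s1 (b # qs) = (b' # qs1, s3)" using 2 3 by simp
    then have "successively (\<lambda>a b. (a \<le> b) = c) (b # qs) \<longleftrightarrow>
        successively (\<lambda>a b. pushed_le e a b = c) (b' # qs1)"
      using "3.IH"(2)[OF s1] "3.prems" 3 by auto
    then show ?case
      using push_push[OF _ _ _ 1 2] "3.prems" 1 2 3 by auto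
  qed (auto split: prod.splits)
  then show ?thesis
    by (subst (1 2) successively_conv_sorted_wrt[symmetric])
      (auto simp: transp_def pushed_le_def)
qed

end

text \<open>
  The words of dual rows: weakly increasing indices for an even row (\<open>c\<close>), strictly decreasing ones
  for an odd row. Indices run against the order of \<open>\<nat>\<^sup>\<or>\<close>.
\<close>

definition V_words :: "bool \<Rightarrow> nat list set"
  where "V_words c = {ys. 0 \<notin> set ys \<and> sorted_wrt (\<lambda>a b. (a \<le> b) = c) ys}"

definition V_fam :: "bool \<Rightarrow> (nat list, (nat, nat) label) fam"
  where "V_fam c = (V_words c, \<lambda>ys. Label 0 (length ys) (Vw ys))"

text \<open>
  The possible entries of \<open>Z\<close> at a pair of rows, where \<open>d\<close> says that their degrees differ.
\<close>

definition t_fam :: "bool \<Rightarrow> (nat, (nat, nat) label) fam"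
  where "t_fam d = ({z. d \<longrightarrow> z \<le> 1}, \<lambda>z. Label z z (V 0 ^ z))"

lemma V_0_power_central: "V 0 ^ n * x = x * V 0 ^ n"
proof (induction n)
  case (Suc n)
  have "V 0 ^ Suc n * x = (V 0 * x) * V 0 ^ n"
    using Suc by (simp add: mult.assoc)
  also have "\<dots> = x * V 0 ^ Suc n"
    unfolding V_0_central[of x] by (simp add: mult.assoc)
  finally show ?case .
qed simp

lemma t_fam_central: "fam_central (t_fam d)"
  unfolding fam_central_def
proof (intro ballI allI)
  fix z l
  show "snd (t_fam d) z * l = l * snd (t_fam d) z"
    by (cases l) (simp add: t_fam_def V_0_power_central add.commute)
qed

lemma Vw_filter: "Vw ls = V 0 ^ count_list ls 0 * Vw (filter (\<lambda>a. a \<noteq> 0) ls)"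
proof (induction ls)
  case (Cons a ls)
  have "V b * (V 0 ^ n * x) = V 0 ^ n * (V b * x)" for b n x
    by (metis V_0_power_central mult.assoc)
  with Cons show ?case by (simp add: mult.assoc)
qed simp

lemma sorted_wrt_zeros:
  "sorted_wrt (\<lambda>a b. pushed_le e a b = c) (replicate z 0) \<longleftrightarrow> (e \<noteq> c \<longrightarrow> z \<le> 1)"
proof (cases "e = c")
  case True
  then show ?thesis by (induction z) (auto simp: pushed_le_def)
next
  case False
  then show ?thesis by (cases z rule: nat.exhaust[of _, case_names 0 Suc]; cases "z - 1")
     (auto simp: pushed_le_def)
qed

text \<open>
  Letters \<open>0\<close> in a word of pushed letters form an initial segment if the dual row is even, and a final
  segment if it is odd (the next lemma). Their number and the remaining word thus determine the word.
\<close>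

lemma zero_first:
  assumes "sorted_wrt (pushed_le e) ls"
  shows "ls = replicate (count_list ls 0) 0 @ filter (\<lambda>a. a \<noteq> 0) ls"
  using assms
proof (induction ls)
  case (Cons a ls)
  show ?case
  proof (cases "a = 0")
    case True
    with Cons show ?thesis by simp
  next
    case False
    with Cons have "0 \<notin> set ls" by (auto simp: pushed_le_def)
    then have "filter (\<lambda>a. a \<noteq> 0) ls = ls" by (intro filter_True ballI notI) simp
    with False \<open>0 \<notin> set ls\<close> show ?thesis by simp
  qed
qed simp

lemma zero_last:
  assumes "sorted_wrt (\<lambda>a b. \<not> pushed_le e a b) ls"
  shows "ls = filter (\<lambda>a. a \<noteq> 0) ls @ replicate (count_list ls 0) 0"
  using assms
proof (induction ls)
  case (Cons a ls)
  show ?case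
  proof (cases "a = 0")
    case True
    with Cons have "\<forall>b\<in>set ls. b = 0" by (auto simp: pushed_le_def)
    then have "ls = replicate (length ls) 0" by (simp add: replicate_length_same)
    then obtain n where n: "ls = replicate n 0" by blast
    have "count_list (replicate n 0) (0::nat) = n" for n by (induction n) auto
    with True n show ?thesis by simp
  next
    case False
    with Cons show ?thesis by simp
  qed
qed simp

definition pushed_words :: "bool \<Rightarrow> bool \<Rightarrow> nat list set"
  where "pushed_words e c = {ls. sorted_wrt (\<lambda>a b. pushed_le e a b = c) ls}"

definition pushed_fam :: "bool \<Rightarrow> bool \<Rightarrow> (nat list, (nat, nat) label) fam"
  where "pushed_fam e c =
    (pushed_words e c, \<lambda>ls. Label (count_list ls 0) (length ls) (Vw ls))"

text \<open>
  Splitting off the zeros: they make up the factor \<open>t\<^sup>z\<close>. At most one zero can occur exactly when the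
  row and the dual row have different degrees, which is the condition on the entries of \<open>Z\<close>.
\<close>

lemma pushed_fam_split: "pushed_fam e c \<approx> V_fam c \<otimes> t_fam (e \<noteq> c)"
  unfolding pushed_fam_def V_fam_def t_fam_def fam_mult_def fst_conv snd_conv
proof (rule fam_eqI)
  let ?h = "\<lambda>ls :: nat list. (filter (\<lambda>a. a \<noteq> 0) ls, count_list ls 0)"
  let ?k = "\<lambda>(ys :: nat list, z :: nat). if c then replicate z 0 @ ys else ys @ replicate z 0"
  have len: "length ls = length (filter (\<lambda>a. a \<noteq> 0) ls) + count_list ls 0" for ls :: "nat list"
    by (induction ls) auto
  have pos: "sorted_wrt (\<lambda>a b. (a \<le> b) = c) ys \<longleftrightarrow> sorted_wrt (\<lambda>a b. pushed_le e a b = c) ys"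
    if "0 \<notin> set ys" for ys :: "nat list"
    using that by (intro iffI; elim sorted_wrt_mono_rel[rotated]) (auto simp: pushed_le_def)
  fix ls :: "nat list" assume "ls \<in> pushed_words e c"
  then have ls: "sorted_wrt (\<lambda>a b. pushed_le e a b = c) ls" by (simp add: pushed_words_def)
  have k: "?k (?h ls) = ls"
    using ls zero_first[of e ls] zero_last[of e ls] by (cases c) auto
  have "sorted_wrt (\<lambda>a b. pushed_le e a b = c) (?k (?h ls))" using ls k by simp
  then have "sorted_wrt (\<lambda>a b. pushed_le e a b = c) (replicate (count_list ls 0) 0)"
    by (cases c) (auto simp: sorted_wrt_append)
  then have z: "e \<noteq> c \<longrightarrow> count_list ls 0 \<le> 1" by (simp only: sorted_wrt_zeros)
  show "?h ls \<in> V_words c \<times> {z. e \<noteq> c \<longrightarrow> z \<le> 1} \<and> ?k (?h ls) = ls \<and>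
    (case ?h ls of (ys, z) \<Rightarrow> Label 0 (length ys) (Vw ys) * Label z z (V 0 ^ z)) =
      Label (count_list ls 0) (length ls) (Vw ls)"
    using z k len[of ls] pos[of "filter (\<lambda>a. a \<noteq> 0) ls"] sorted_wrt_filter[OF ls]
    by (auto simp: V_words_def Vw_filter[of ls] V_0_power_central)
next
  let ?h = "\<lambda>ls :: nat list. (filter (\<lambda>a. a \<noteq> 0) ls, count_list ls 0)"
  let ?k = "\<lambda>(ys :: nat list, z :: nat). if c then replicate z 0 @ ys else ys @ replicate z 0"
  fix yz :: "nat list \<times> nat" assume "yz \<in> V_words c \<times> {z. e \<noteq> c \<longrightarrow> z \<le> 1}"
  then obtain ys z where yz: "yz = (ys, z)" and ys: "0 \<notin> set ys" "sorted_wrt (\<lambda>a b. (a \<le> b) = c) ys"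
    and z: "e \<noteq> c \<longrightarrow> z \<le> 1" by (auto simp: V_words_def)
  have pos: "sorted_wrt (\<lambda>a b. pushed_le e a b = c) ys"
    using ys by (elim sorted_wrt_mono_rel[rotated]) (auto simp: pushed_le_def)
  have zs: "sorted_wrt (\<lambda>a b. pushed_le e a b = c) (replicate z 0)" 
    using z by (simp only: sorted_wrt_zeros) 
  have cnt: "count_list (replicate z 0) (0::nat) = z" for z by (induction z) auto
  have nz: "b \<noteq> 0" if "b \<in> set ys" for b using that ys by metis
  have srt: "sorted_wrt (\<lambda>a b. pushed_le e a b = c) (?k yz)"
    using pos zs nz unfolding yz by (auto simp: sorted_wrt_append pushed_le_def)
  have "filter (\<lambda>a. a \<noteq> 0) ys = ys" using nz by (simp add: filter_id_conv)
  with srt show "?k yz \<in> pushed_words e c \<and> ?h (?k yz) = yz"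
    using ys unfolding yz by (auto simp: pushed_words_def cnt)
qed

context letter_exchange
begin

lemma row_exchange:
  "(St, \<lambda>s. Label (len s) 0 (word s)) \<otimes> V_fam c \<approx>
    V_fam c \<otimes> (St, \<lambda>s. Label (len s) 0 (word s)) \<otimes> t_fam (e \<noteq> c)" (is "?R \<otimes> _ \<approx> _")
proof -
  have "?R \<otimes> V_fam c \<approx> pushed_fam e c \<otimes> ?R"
    unfolding fam_mult_def V_fam_def pushed_fam_def fst_conv snd_conv
  proof (rule fam_eqI)
    fix x assume "x \<in> St \<times> V_words c"
    then obtain s qs where x: "x = (s, qs)" "s \<in> St" "0 \<notin> set qs"
      "sorted_wrt (\<lambda>a b. (a \<le> b) = c) qs" by (auto simp: V_words_def)
    obtain qs' s' where 1: "push_word s qs = (qs', s')" by fastforce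
    show "case_prod push_word x \<in> pushed_words e c \<times> St \<and>
      case_prod pull_word (case_prod push_word x) = x \<and>
      (case case_prod push_word x of
        (i, j) \<Rightarrow> Label (count_list i 0) (length i) (Vw i) * Label (len j) 0 (word j)) =
      (case x of (i, j) \<Rightarrow> Label (len i) 0 (word i) * Label 0 (length j) (Vw j))"
      using push_word[OF x(2,3) 1] push_word_sorted[OF x(2,3) 1, of c] x 1
      by (auto simp: pushed_words_def)
  next
    fix y assume "y \<in> pushed_words e c \<times> St"
    then obtain qs' s' where y: "y = (qs', s')" "s' \<in> St"
      "sorted_wrt (\<lambda>a b. pushed_le e a b = c) qs'" by (auto simp: pushed_words_def)
    obtain s qs where 1: "pull_word qs' s' = (s, qs)" by fastforce
    show "case_prod pull_word y \<in> St \<times> V_words c \<and> case_prod push_word (case_prod pull_word y) = y"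
      using pull_word[OF y(2) 1] push_word_sorted[of s qs qs' s' c] y 1
      by (auto simp: V_words_def)
  qed
  also have "\<dots> \<approx> (V_fam c \<otimes> t_fam (e \<noteq> c)) \<otimes> ?R"
    by (intro fam_mult_cong1 pushed_fam_split)
  also have "\<dots> \<approx> V_fam c \<otimes> (t_fam (e \<noteq> c) \<otimes> ?R)"
    by (rule fam_mult_assoc)
  also have "\<dots> \<approx> V_fam c \<otimes> (?R \<otimes> t_fam (e \<noteq> c))"
    by (intro fam_mult_cong2 fam_mult_commute t_fam_central)
  finally show ?thesis .
qed

end

section \<open>Even rows as multisets\<close>

lemma sorted_list_of_multiset_unique: "sorted xs \<Longrightarrow> mset xs = M \<Longrightarrow> xs = sorted_list_of_multiset M"
  by (metis sorted_list_of_multiset_mset sorted_sort_id)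

definition mset_word :: "nat multiset \<Rightarrow> U_alg"
  where "mset_word M = Uw (rev (sorted_list_of_multiset M))"

lemma mset_word_union:
  assumes "\<And>x y. x \<in># M \<Longrightarrow> y \<in># N \<Longrightarrow> y \<le> x"
  shows "mset_word (M + N) = mset_word M * mset_word N"
proof -
  have "sorted_list_of_multiset (M + N) = sorted_list_of_multiset N @ sorted_list_of_multiset M"
    by (rule sorted_list_of_multiset_unique[symmetric]) (use assms in \<open>auto simp: sorted_append\<close>)
  then show ?thesis by (simp add: mset_word_def)
qed

lemma mset_word_V_commute: "q \<notin># M \<Longrightarrow> mset_word M * V q = V q * mset_word M"
  by (simp add: mset_word_def Uw_V_commute)

text \<open>
  The smaller letters of the row commute with \<open>v\<^bsub>q+1\<^esub>\<close>; the last letter \<open>u\<^bsub>q+1\<^esub>\<close> turns it into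
  \<open>v\<^sub>q\<close>; all letters further left are larger than \<open>q\<close> and commute with that.
\<close>

lemma mset_word_V:
  assumes "Suc q \<in># M"
  shows "mset_word M * V (Suc q) = V q * mset_word (add_mset q (M - {#Suc q#}))"
proof -
  define N where "N = M - {#Suc q#}"
  define A where "A = filter_mset (\<lambda>x. Suc q \<le> x) N"
  define B where "B = filter_mset (\<lambda>x. \<not> Suc q \<le> x) N"
  have N: "N = A + B" unfolding A_def B_def by (rule multiset_partition)
  have "M = add_mset (Suc q) N" using assms by (simp add: N_def)
  with N have M: "M = A + ({#Suc q#} + B)" and M': "add_mset q N = A + ({#q#} + B)"
    by simp_all
  have word: "mset_word (A + ({#x#} + B)) = mset_word A * (U x * mset_word B)"
    if "q \<le> x" "x \<le> Suc q" for x
    using that by (subst mset_word_union, force simp: A_def B_def)+ (simp add: mset_word_def)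
  have "mset_word M * V (Suc q) = mset_word A * (U (Suc q) * (mset_word B * V (Suc q)))"
    unfolding M by (subst word) (simp_all add: mult.assoc)
  also have "mset_word B * V (Suc q) = V (Suc q) * mset_word B"
    by (rule mset_word_V_commute) (simp add: B_def)
  also have "U (Suc q) * (V (Suc q) * mset_word B) = V q * (U q * mset_word B)"
    by (simp add: U_V_same flip: mult.assoc)
  also have "mset_word A * (V q * (U q * mset_word B)) = V q * (mset_word A * (U q * mset_word B))"
    using mset_word_V_commute[of q A] by (simp add: A_def flip: mult.assoc)
  also have "mset_word A * (U q * mset_word B) = mset_word (add_mset q N)"
    unfolding M' by (subst word) simp_all
  finally show ?thesis unfolding N_def .
qed

lemma mset_word_add_0: "mset_word (add_mset 0 M) = mset_word M"
  using mset_word_union[of M "{#0#}"] by (simp add: mset_word_def U_def)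

definition push_even :: "nat multiset \<Rightarrow> nat \<Rightarrow> nat \<times> nat multiset"
  where "push_even M q = (if q \<in># M
    then (q - 1, if q = 1 then M - {#1#} else add_mset (q - 1) (M - {#q#})) else (q, M))"

definition pull_even :: "nat \<Rightarrow> nat multiset \<Rightarrow> nat multiset \<times> nat"
  where "pull_even q M = (if q = 0 \<or> q \<in># M
    then (add_mset (Suc q) (M - {#q#}), Suc q) else (M, q))"

text \<open>
  At an even row the index of the pushed letter drops by one if the row contains it, and does not
  change otherwise. If it drops, the resulting row contains the new index (or the new index is \<open>0\<close>);
  if not, it does not: this is what makes the step invertible.
\<close>

interpretation even_row: letter_exchange True "{M. 0 \<notin># M}" mset_word size push_even pull_even
proof
  fix M M' :: "nat multiset" and q q' :: nat
  assume M: "M \<in> {M. 0 \<notin># M}" and "q \<noteq> 0" and p: "push_even M q = (q', M')"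
  then obtain r where r: "q = Suc r" using not0_implies_Suc by blast
  show "M' \<in> {M. 0 \<notin># M} \<and> pull_even q' M' = (M, q) \<and>
      mset_word M * V q = V q' * mset_word M' \<and> size M = size M' + (if q' = 0 then 1 else 0)"
  proof (cases "q \<in># M")
    case True
    have "mset_word M * V q = V r * mset_word M'" if "r = 0"
      using p True mset_word_V[of r M] that r by (auto simp: push_even_def mset_word_add_0)
    moreover have "mset_word M * V q = V r * mset_word M'" if "r \<noteq> 0"
      using p True mset_word_V[of r M] that r by (auto simp: push_even_def)
    moreover have "size M = Suc (size (M - {#q#}))"
      using True by (metis insert_DiffM size_add_mset)
    ultimately show ?thesis
      using M p True r by (auto simp: push_even_def pull_even_def dest: in_diffD)
  next
    case False
    then show ?thesis
      using M p r by (auto simp: push_even_def pull_even_def mset_word_V_commute)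
  qed
next
  fix M M' :: "nat multiset" and q q' :: nat
  assume "M' \<in> {M. 0 \<notin># M}" and "pull_even q' M' = (M, q)"
  then show "M \<in> {M. 0 \<notin># M} \<and> q \<noteq> 0 \<and> push_even M q = (q', M')"
    by (auto simp: push_even_def pull_even_def diff_single_trivial split: if_splits dest: in_diffD)
next
  fix M M1 M2 :: "nat multiset" and a b a' b' :: nat
  assume "M \<in> {M. 0 \<notin># M}" "a \<noteq> 0" "b \<noteq> 0" "push_even M a = (a', M1)" "push_even M1 b = (b', M2)"
  then show "a \<le> b \<longleftrightarrow> pushed_le True a' b'"
    by (cases a b rule: linorder_cases)
      (auto simp: push_even_def pushed_le_def split: if_splits dest: in_diffD)
qed

section \<open>Odd rows as finite sets\<close>

definition set_word :: "nat set \<Rightarrow> U_alg"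
  where "set_word P = Uw (sorted_list_of_set P)"

lemma set_word_union:
  assumes "finite P" "finite Q" "\<And>x y. x \<in> P \<Longrightarrow> y \<in> Q \<Longrightarrow> x < y"
  shows "set_word (P \<union> Q) = set_word P * set_word Q"
proof -
  have "sorted_list_of_set (P \<union> Q) = sorted_list_of_set P @ sorted_list_of_set Q"
    by (rule sorted_distinct_set_unique) (use assms in \<open>force simp: sorted_append\<close>)+
  then show ?thesis by (simp add: set_word_def)
qed

lemma set_word_V_commute: "finite P \<Longrightarrow> q \<notin> P \<Longrightarrow> set_word P * V q = V q * set_word P"
  by (simp add: set_word_def Uw_V_commute)

text \<open>
  Only the run of the row that ends in \<open>q\<close> interacts with \<open>v\<^sub>q\<close>; the rest of the row lies beyond
  \<open>q\<close> or below the gap \<open>g\<close> and commutes with the letter that passes it.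
\<close>

lemma set_word_V:
  assumes "finite P" "g < q" "g \<notin> P" "\<And>x. g < x \<Longrightarrow> x \<le> q \<Longrightarrow> x \<in> P"
  shows "set_word P * V q = V g * set_word (insert g (P - {q}))"
proof -
  define A where "A = {x \<in> P. x < g}"
  define B where "B = {x \<in> P. q < x}"
  have fin: "finite A" "finite B" using assms(1) by (auto simp: A_def B_def)
  have "x \<in> P \<longleftrightarrow> x \<in> A \<union> ({Suc g..<Suc q} \<union> B)"
    and "x \<in> insert g (P - {q}) \<longleftrightarrow> x \<in> A \<union> ({g..<q} \<union> B)" for x
    by (cases x g rule: linorder_cases; use assms in \<open>auto simp: A_def B_def\<close>)+
  then have P: "P = A \<union> ({Suc g..<Suc q} \<union> B)" and P': "insert g (P - {q}) = A \<union> ({g..<q} \<union> B)"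
    by blast+
  have word: "set_word (A \<union> ({l..<r} \<union> B)) = set_word A * (Uw [l..<r] * set_word B)"
    if "g \<le> l" "r \<le> Suc q" for l r
  proof -
    have "set_word (A \<union> ({l..<r} \<union> B)) = set_word A * set_word ({l..<r} \<union> B)"
      using fin that assms(2) by (intro set_word_union) (auto simp: A_def B_def)
    also have "set_word ({l..<r} \<union> B) = set_word {l..<r} * set_word B"
      using fin that by (intro set_word_union) (auto simp: B_def)
    finally show ?thesis by (simp add: set_word_def)
  qed
  have "set_word P * V q = set_word A * (Uw [Suc g..<Suc q] * (set_word B * V q))"
    by (subst P) (simp only: word mult.assoc le_refl le_SucI order.refl)
  also have "set_word B * V q = V q * set_word B"
    by (rule set_word_V_commute) (simp_all add: fin, simp add: B_def)
  also have "Uw [Suc g..<Suc q] * (V q * set_word B) = V g * (Uw [g..<q] * set_word B)"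
    using Uw_interval_V[of g q] assms(2) by (simp flip: mult.assoc)
  also have "set_word A * (V g * (Uw [g..<q] * set_word B)) =
      V g * (set_word A * (Uw [g..<q] * set_word B))"
    using set_word_V_commute[OF fin(1), of g] by (simp add: A_def flip: mult.assoc)
  also have "set_word A * (Uw [g..<q] * set_word B) = set_word (insert g (P - {q}))"
    unfolding P' by (simp add: word)
  finally show ?thesis .
qed

lemma set_word_diff_0:
  assumes "finite P"
  shows "set_word (P - {0}) = set_word P"
proof (cases "0 \<in> P")
  case True
  have "set_word ({0} \<union> (P - {0})) = set_word {0} * set_word (P - {0})"
    using assms by (intro set_word_union) auto
  with True show ?thesis by (simp add: set_word_def U_def insert_absorb)
qed simp

definition gap_below :: "nat set \<Rightarrow> nat \<Rightarrow> nat"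
  where "gap_below P q = Max {x. x \<le> q \<and> x \<notin> P}"

definition gap_above :: "nat set \<Rightarrow> nat \<Rightarrow> nat"
  where "gap_above P g = (LEAST x. g < x \<and> x \<notin> P)"

lemma gap_below:
  assumes "0 \<notin> P"
  shows "gap_below P q \<le> q" "gap_below P q \<notin> P" "gap_below P q < x \<Longrightarrow> x \<le> q \<Longrightarrow> x \<in> P"
proof -
  have fin: "finite {x. x \<le> q \<and> x \<notin> P}" by simp
  have "gap_below P q \<in> {x. x \<le> q \<and> x \<notin> P}"
    unfolding gap_below_def using assms by (intro Max_in fin) auto
  then show "gap_below P q \<le> q" "gap_below P q \<notin> P" by auto
  show "x \<in> P" if "gap_below P q < x" "x \<le> q"
    using that Max_ge[OF fin, of x] unfolding gap_below_def
    by (metis (mono_tags, lifting) mem_Collect_eq not_le)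
qed

lemma gap_below_eqI:
  assumes "g \<le> q" "g \<notin> P" "\<And>x. g < x \<Longrightarrow> x \<le> q \<Longrightarrow> x \<in> P"
  shows "gap_below P q = g"
  unfolding gap_below_def using assms by (intro Max_eqI) (auto intro: leI)

lemma gap_above:
  assumes "finite P"
  shows "g < gap_above P g" "gap_above P g \<notin> P" "g < x \<Longrightarrow> x < gap_above P g \<Longrightarrow> x \<in> P"
proof -
  have "infinite ({g<..} - P)" using assms by (simp add: infinite_Ioi)
  then obtain y where "g < y \<and> y \<notin> P"
    by (metis Diff_iff finite.emptyI greaterThan_iff ex_in_conv)
  then have "g < gap_above P g \<and> gap_above P g \<notin> P"
    unfolding gap_above_def by (rule LeastI)
  then show "g < gap_above P g" "gap_above P g \<notin> P" by auto
  show "x \<in> P" if "g < x" "x < gap_above P g"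
    using not_less_Least[OF that(2)[unfolded gap_above_def]] that(1) by blast
qed

lemma gap_above_eqI:
  assumes "g < q" "q \<notin> P" "\<And>x. g < x \<Longrightarrow> x < q \<Longrightarrow> x \<in> P"
  shows "gap_above P g = q"
  unfolding gap_above_def using assms by (intro Least_equality) (auto intro: leI)

definition push_odd :: "nat set \<Rightarrow> nat \<Rightarrow> nat \<times> nat set"
  where "push_odd P q =
    (let g = gap_below P q in (g, if q \<in> P then insert g (P - {q}) - {0} else P))"

definition pull_odd :: "nat \<Rightarrow> nat set \<Rightarrow> nat set \<times> nat"
  where "pull_odd g P = (if g = 0 \<or> g \<in> P
    then let q = gap_above P g in (insert q (P - {g}), q) else (P, g))"

lemma push_odd_notin: "q \<notin> P \<Longrightarrow> push_odd P q = (q, P)"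
  using gap_below_eqI[of q q P] by (simp add: push_odd_def)

text \<open>
  At an odd row the pushed letter falls to the largest index \<open>\<le> q\<close> missing from the row, and \<open>q\<close> is
  replaced by that index. If \<open>q\<close> was in the row, the new row contains the new index (unless that is
  \<open>0\<close>) and every index strictly between it and \<open>q\<close>, but not \<open>q\<close>, so that \<open>q\<close> is recovered as
  the first gap above. If \<open>q\<close> was not in the row, nothing changes.
\<close>

interpretation odd_row: letter_exchange False "{P. finite P \<and> 0 \<notin> P}" set_word card push_odd pull_odd
proof
  fix P P' :: "nat set" and q g :: nat
  assume "P \<in> {P. finite P \<and> 0 \<notin> P}" and "q \<noteq> 0" and p: "push_odd P q = (g, P')"
  then have P: "finite P" "0 \<notin> P" by auto
  show "P' \<in> {P. finite P \<and> 0 \<notin> P} \<and> pull_odd g P' = (P, q) \<and>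
      set_word P * V q = V g * set_word P' \<and> card P = card P' + (if g = 0 then 1 else 0)"
  proof (cases "q \<in> P")
    case True
    have g: "g = gap_below P q" and P': "P' = insert g (P - {q}) - {0}"
      using p True by (auto simp: push_odd_def Let_def)
    note gap = gap_below[OF P(2), of q, folded g]
    have "g < q" using gap True by (metis le_neq_implies_less)
    have "gap_above P' g = q"
      unfolding P' using gap \<open>g < q\<close> by (intro gap_above_eqI) auto
    moreover have "insert q (P' - {g}) = P"
      unfolding P' using gap P True by auto
    moreover have "set_word P * V q = V g * set_word P'"
      unfolding P' using set_word_V[OF P(1) \<open>g < q\<close> gap(2,3)] P by (simp add: set_word_diff_0)
    moreover have "card P = card P' + (if g = 0 then 1 else 0)"
    proof -
      have "card (insert g (P - {q})) = card P"
        using P True gap(2) by (simp add: card_Suc_Diff1 del: card_Diff_insert)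
      moreover have "insert 0 (P - {q}) - {0} = P - {q}" using P by auto
      ultimately show ?thesis
        unfolding P' using P gap(2) True by (auto simp: card_Suc_Diff1 simp del: card_Diff_insert)
    qed
    ultimately show ?thesis
      using P unfolding P' by (auto simp: pull_odd_def Let_def)
  next
    case False
    then show ?thesis
      using p P \<open>q \<noteq> 0\<close> by (auto simp: push_odd_notin pull_odd_def set_word_V_commute)
  qed
next
  fix P P' :: "nat set" and q g :: nat
  assume "P' \<in> {P. finite P \<and> 0 \<notin> P}" and p: "pull_odd g P' = (P, q)"
  then have P': "finite P'" "0 \<notin> P'" by auto
  show "P \<in> {P. finite P \<and> 0 \<notin> P} \<and> q \<noteq> 0 \<and> push_odd P q = (g, P')"
  proof (cases "g = 0 \<or> g \<in> P'")
    case True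
    then have q: "q = gap_above P' g" and P: "P = insert q (P' - {g})"
      using p by (auto simp: pull_odd_def Let_def)
    note gap = gap_above[OF P'(1), of g, folded q]
    have "gap_below P q = g"
      unfolding P using gap by (intro gap_below_eqI) (auto simp: le_less)
    moreover have "insert g (P - {q}) - {0} = P'"
      unfolding P using gap P' True by auto
    ultimately show ?thesis
      using P' gap(1) unfolding P by (auto simp: push_odd_def)
  next
    case False
    then show ?thesis
      using p P' by (auto simp: pull_odd_def push_odd_notin)
  qed
next
  fix P P1 P2 :: "nat set" and a b a' b' :: nat
  assume "P \<in> {P. finite P \<and> 0 \<notin> P}" and ab: "a \<noteq> 0" "b \<noteq> 0"
    and p: "push_odd P a = (a', P1)" "push_odd P1 b = (b', P2)"
  then have P: "0 \<notin> P" by auto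
  have a': "a' = gap_below P a" and b': "b' = gap_below P1 b"
    and P1: "P1 = (if a \<in> P then insert a' (P - {a}) - {0} else P)"
    using p by (auto simp: push_odd_def Let_def)
  note ga = gap_below[OF P, of a, folded a']
  have "0 \<notin> P1" using P by (auto simp: P1)
  note gb = gap_below[OF this, of b, folded b']
  have "a \<notin> P1" using ga by (auto simp: P1)
  show "a \<le> b \<longleftrightarrow> pushed_le False a' b'"
  proof (cases "a \<le> b")
    case True
    have "a \<le> b'" using gb(3)[of a] True \<open>a \<notin> P1\<close> by (meson leI)
    then show ?thesis using True ga(1) ab by (auto simp: pushed_le_def)
  next
    case False
    have "b' < a' \<or> b' = 0 \<and> a' = 0"
    proof (cases "a \<in> P \<and> a' \<le> b")
      case True
      have run: "x \<in> P1" if "a' < x" "x \<le> b" for x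
        using that ga(3)[of x] False True by (auto simp: P1)
      have "b' \<le> a'" using run[of b'] gb by (meson leI)
      moreover have "a' \<noteq> 0 \<Longrightarrow> a' \<in> P1" using True by (simp add: P1)
      ultimately show ?thesis using gb(2) by (metis le_neq_implies_less le_zero_eq)
    next
      case False
      then show ?thesis using ga gb \<open>\<not> a \<le> b\<close> gap_below_eqI[of a a P] a' by fastforce
    qed
    then show ?thesis using False by (auto simp: pushed_le_def)
  qed
qed

section \<open>Exchange of two rows\<close>

text \<open>
  The words of rows: weakly decreasing for an even row (\<open>e\<close>), strictly increasing for an odd row.
\<close>

definition U_words :: "bool \<Rightarrow> nat list set"
  where "U_words e = {xs. 0 \<notin> set xs \<and> sorted_wrt (\<lambda>a b. (b \<le> a) = e) xs}"

definition U_fam :: "bool \<Rightarrow> (nat list, (nat, nat) label) fam"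
  where "U_fam e = (U_words e, \<lambda>xs. Label (length xs) 0 (Uw xs))"

lemma U_fam_even: "U_fam True \<approx> ({M. 0 \<notin># M}, \<lambda>M. Label (size M) 0 (mset_word M))"
  unfolding U_fam_def
proof (rule fam_eqI[where h = mset and k = "\<lambda>M. rev (sorted_list_of_multiset M)"])
  fix xs assume "xs \<in> U_words True"
  then have "sorted (rev xs)" "0 \<notin> set xs" by (auto simp: U_words_def sorted_wrt_rev)
  moreover from this have "sorted_list_of_multiset (mset xs) = rev xs"
    by (metis mset_rev sorted_list_of_multiset_unique)
  ultimately show "mset xs \<in> {M. 0 \<notin># M} \<and> rev (sorted_list_of_multiset (mset xs)) = xs \<and>
    Label (size (mset xs)) 0 (mset_word (mset xs)) = Label (length xs) 0 (Uw xs)"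
    by (simp add: mset_word_def)
next
  fix M :: "nat multiset" assume "M \<in> {M. 0 \<notin># M}"
  then show "rev (sorted_list_of_multiset M) \<in> U_words True \<and>
      mset (rev (sorted_list_of_multiset M)) = M"
    using sorted_sorted_list_of_multiset[of M] by (simp add: U_words_def sorted_wrt_rev)
qed

lemma U_fam_odd: "U_fam False \<approx> ({P. finite P \<and> 0 \<notin> P}, \<lambda>P. Label (card P) 0 (set_word P))"
  unfolding U_fam_def
proof (rule fam_eqI[where h = set and k = sorted_list_of_set])
  fix xs assume "xs \<in> U_words False"
  then have "sorted_wrt (<) xs" "0 \<notin> set xs"
    by (auto simp: U_words_def not_le)
  then show "set xs \<in> {P. finite P \<and> 0 \<notin> P} \<and> sorted_list_of_set (set xs) = xs \<and>
    Label (card (set xs)) 0 (set_word (set xs)) = Label (length xs) 0 (Uw xs)"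
    by (simp add: set_word_def strict_sorted_iff distinct_card sorted_list_of_set.idem_if_sorted_distinct)
next
  fix P :: "nat set" assume "P \<in> {P. finite P \<and> 0 \<notin> P}"
  then show "sorted_list_of_set P \<in> U_words False \<and> set (sorted_list_of_set P) = P"
    using sorted_list_of_set.strict_sorted_key_list_of_set[of P] by (simp add: U_words_def not_le)
qed

text \<open>
  The theorem for a single row and a single dual row.
\<close>

lemma word_exchange: "U_fam e \<otimes> V_fam c \<approx> V_fam c \<otimes> U_fam e \<otimes> t_fam (e \<noteq> c)"
proof -
  have *: "U_fam e \<otimes> V_fam c \<approx> V_fam c \<otimes> U_fam e \<otimes> t_fam (e \<noteq> c)"
    if "U_fam e \<approx> S" "S \<otimes> V_fam c \<approx> V_fam c \<otimes> S \<otimes> t_fam (e \<noteq> c)"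
    for e and S :: "('s, (nat, nat) label) fam"
  proof -
    have "U_fam e \<otimes> V_fam c \<approx> S \<otimes> V_fam c" by (intro fam_mult_cong1 that)
    also note that(2)
    also have "V_fam c \<otimes> S \<otimes> t_fam (e \<noteq> c) \<approx> V_fam c \<otimes> U_fam e \<otimes> t_fam (e \<noteq> c)"
      by (intro fam_mult_cong2 fam_mult_cong1 that(1)[THEN fam_eq_sym])
    finally show ?thesis .
  qed
  show ?thesis
    using *[OF U_fam_even even_row.row_exchange] *[OF U_fam_odd odd_row.row_exchange] by (cases e) simp_all
qed

section \<open>Matrices\<close>

definition madd :: "('c \<Rightarrow> 'd \<Rightarrow> nat) \<Rightarrow> ('c \<Rightarrow> 'd \<Rightarrow> nat) \<Rightarrow> 'c \<Rightarrow> 'd \<Rightarrow> nat"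
  where "madd M N = (\<lambda>i j. M i j + N i j)"

definition mrestrict :: "('c \<times> 'd) set \<Rightarrow> ('c \<Rightarrow> 'd \<Rightarrow> nat) \<Rightarrow> 'c \<Rightarrow> 'd \<Rightarrow> nat"
  where "mrestrict S M = (\<lambda>i j. if (i, j) \<in> S then M i j else 0)"

lemma supp_madd: "supp (madd M N) = supp M \<union> supp N"
  by (auto simp: supp_def madd_def)

lemma supp_mrestrict: "supp (mrestrict S M) = supp M \<inter> S"
  by (auto simp: supp_def mrestrict_def)

lemma mats_finite: "M \<in> mats C dC D dD \<Longrightarrow> finite (supp M)"
  by (simp add: mats_def)

lemma mats_outside: "M \<in> mats C dC D dD \<Longrightarrow> (i, j) \<notin> C \<times> D \<Longrightarrow> M i j = 0"
  by (auto simp: mats_def supp_def)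

lemma mats_mono:
  assumes "C \<subseteq> C'" "D \<subseteq> D'"
  shows "mats C dC D dD \<subseteq> mats C' dC D' dD"
proof
  fix M assume M: "M \<in> mats C dC D dD"
  have "M i j \<le> 1" if "dC i \<noteq> dD j" for i j
    using M mats_outside[OF M, of i j] that by (cases "(i, j) \<in> C \<times> D") (simp_all add: mats_def)
  moreover have "C \<times> D \<subseteq> C' \<times> D'" using assms by blast
  ultimately show "M \<in> mats C' dC D' dD"
    using M unfolding mats_def by blast
qed

lemma sum_supp_madd:
  fixes \<phi> :: "'c \<Rightarrow> 'd \<Rightarrow> nat \<Rightarrow> 'm::comm_monoid_add"
  assumes fin: "finite (supp M)" "finite (supp N)"
    and \<phi>: "\<And>i j. \<phi> i j 0 = 0" "\<And>i j m n. \<phi> i j (m + n) = \<phi> i j m + \<phi> i j n"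
  shows "(\<Sum>(i, j)\<in>supp (madd M N). \<phi> i j (madd M N i j)) =
    (\<Sum>(i, j)\<in>supp M. \<phi> i j (M i j)) + (\<Sum>(i, j)\<in>supp N. \<phi> i j (N i j))"
proof -
  let ?F = "supp M \<union> supp N"
  have F: "(\<Sum>(i, j)\<in>supp L. \<phi> i j (L i j)) = (\<Sum>(i, j)\<in>?F. \<phi> i j (L i j))" if "supp L \<subseteq> ?F" for L
  proof -
    have "\<phi> i j (L i j) = 0" if "(i, j) \<notin> supp L" for i j
      using that by (simp add: supp_def \<phi>(1))
    with that fin show ?thesis by (intro sum.mono_neutral_left) auto
  qed
  show ?thesis
    by (simp add: F supp_madd) (simp add: madd_def \<phi> sum.distrib case_prod_unfold)
qed

lemma wt_row_madd:
  "finite (supp M) \<Longrightarrow> finite (supp N) \<Longrightarrow> wt_row (madd M N) = wt_row M + wt_row N"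
  unfolding wt_row_def by (rule sum_supp_madd) (simp_all add: frag_cmul_distrib)

lemma wt_col_madd:
  "finite (supp M) \<Longrightarrow> finite (supp N) \<Longrightarrow> wt_col (madd M N) = wt_col M + wt_col N"
  unfolding wt_col_def by (rule sum_supp_madd) (simp_all add: frag_cmul_distrib)

lemma msize_madd:
  "finite (supp M) \<Longrightarrow> finite (supp N) \<Longrightarrow> msize (madd M N) = msize M + msize N"
  unfolding msize_def by (rule sum_supp_madd) simp_all

text \<open>
  Rectangles of cells cover both splitting off rows and splitting off columns. The bijection is
  addition of matrices, with restriction to the two blocks as its inverse.
\<close>

lemma mats_fam_split:
  assumes cells: "C \<times> D = C1 \<times> D1 \<union> C2 \<times> D2" "C1 \<times> D1 \<inter> C2 \<times> D2 = {}"
    and lab: "\<And>M N. M \<in> mats C1 dC D1 dD \<Longrightarrow> N \<in> mats C2 dC D2 dD \<Longrightarrow>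
      lab (madd M N) = lab M * lab N"
  shows "(mats C dC D dD, lab) \<approx> (mats C1 dC D1 dD, lab) \<otimes> (mats C2 dC D2 dD, lab)"
proof -
  have "(mats C1 dC D1 dD, lab) \<otimes> (mats C2 dC D2 dD, lab) \<approx> (mats C dC D dD, lab)"
    unfolding fam_mult_def fst_conv snd_conv
  proof (rule fam_eqI[where h = "\<lambda>(M, N). madd M N"
        and k = "\<lambda>M. (mrestrict (C1 \<times> D1) M, mrestrict (C2 \<times> D2) M)"])
    fix x assume "x \<in> mats C1 dC D1 dD \<times> mats C2 dC D2 dD"
    then obtain M N where x: "x = (M, N)" and M: "M \<in> mats C1 dC D1 dD" and N: "N \<in> mats C2 dC D2 dD"
      by (elim SigmaE)
    have zero: "M i j = 0 \<or> N i j = 0" for i j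
    proof -
      have "(i, j) \<notin> C1 \<times> D1 \<or> (i, j) \<notin> C2 \<times> D2" using cells(2) by auto
      then show ?thesis using mats_outside[OF M, of i j] mats_outside[OF N, of i j] by argo
    qed
    have "madd M N i j \<le> 1" if "i \<in> C" "j \<in> D" "dC i \<noteq> dD j" for i j
    proof -
      have "M i j \<le> 1"
        using M that(3) mats_outside[OF M, of i j] by (cases "(i, j) \<in> C1 \<times> D1") (auto simp: mats_def)
      moreover have "N i j \<le> 1"
        using N that(3) mats_outside[OF N, of i j] by (cases "(i, j) \<in> C2 \<times> D2") (auto simp: mats_def)
      ultimately show ?thesis
        using zero[of i j] by (auto simp: madd_def)
    qed
    then have "madd M N \<in> mats C dC D dD"
      using M N cells(1) by (auto simp: mats_def supp_madd)
    moreover have "N i j = 0" if "(i, j) \<in> C1 \<times> D1" for i j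
      using that cells(2) by (metis disjoint_iff mats_outside[OF N])
    then have "mrestrict (C1 \<times> D1) (madd M N) = M"
      using mats_outside[OF M] by (auto simp: mrestrict_def madd_def fun_eq_iff)
    moreover have "M i j = 0" if "(i, j) \<in> C2 \<times> D2" for i j
      using that cells(2) by (metis disjoint_iff mats_outside[OF M])
    then have "mrestrict (C2 \<times> D2) (madd M N) = N"
      using mats_outside[OF N] by (auto simp: mrestrict_def madd_def fun_eq_iff)
    ultimately show "(case x of (M, N) \<Rightarrow> madd M N) \<in> mats C dC D dD \<and>
      (mrestrict (C1 \<times> D1) (case x of (M, N) \<Rightarrow> madd M N),
       mrestrict (C2 \<times> D2) (case x of (M, N) \<Rightarrow> madd M N)) = x \<and>
      lab (case x of (M, N) \<Rightarrow> madd M N) = (case x of (i, j) \<Rightarrow> lab i * lab j)"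
      using lab[OF M N] x by simp
  next
    fix M assume M: "M \<in> mats C dC D dD"
    have "mrestrict (C' \<times> D') M \<in> mats C' dC D' dD" if "C' \<times> D' \<subseteq> C \<times> D" for C' D'
    proof -
      have "mrestrict (C' \<times> D') M i j \<le> 1" if "(i, j) \<in> C' \<times> D'" "dC i \<noteq> dD j" for i j
        using M that subsetD[OF \<open>C' \<times> D' \<subseteq> C \<times> D\<close> that(1)] by (simp add: mats_def mrestrict_def)
      then show ?thesis
        using mats_finite[OF M] unfolding mats_def by (simp add: supp_mrestrict)
    qed
    then have "mrestrict (C1 \<times> D1) M \<in> mats C1 dC D1 dD" "mrestrict (C2 \<times> D2) M \<in> mats C2 dC D2 dD"
      using cells(1) by auto
    moreover have "madd (mrestrict (C1 \<times> D1) M) (mrestrict (C2 \<times> D2) M) = M"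
    proof (intro ext)
      fix i j
      have "(i, j) \<notin> C1 \<times> D1 \<Longrightarrow> (i, j) \<notin> C2 \<times> D2 \<Longrightarrow> M i j = 0"
        using mats_outside[OF M, of i j] unfolding cells(1) by blast
      moreover have "\<not> ((i, j) \<in> C1 \<times> D1 \<and> (i, j) \<in> C2 \<times> D2)"
        using cells(2) by (metis disjoint_iff)
      ultimately show "madd (mrestrict (C1 \<times> D1) M) (mrestrict (C2 \<times> D2) M) i j = M i j"
        unfolding madd_def mrestrict_def
        by (cases "(i, j) \<in> C1 \<times> D1"; cases "(i, j) \<in> C2 \<times> D2") (simp_all del: mem_Sigma_iff)
    qed
    ultimately show "(mrestrict (C1 \<times> D1) M, mrestrict (C2 \<times> D2) M)
        \<in> mats C1 dC D1 dD \<times> mats C2 dC D2 dD \<and>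
      (case (mrestrict (C1 \<times> D1) M, mrestrict (C2 \<times> D2) M) of (M, N) \<Rightarrow> madd M N) = M"
      by simp
  qed
  then show ?thesis by (rule fam_eq_sym)
qed

section \<open>Listings and single rows\<close>

lemma listing_eqI:
  assumes "sorted_wrt (pair_le d) ps" "\<And>i j. count_list ps (i, j) = M i j"
  shows "listing d M = ps"
proof -
  have "supp M \<subseteq> set ps"
    unfolding supp_def assms(2)[symmetric] by (auto simp: count_list_0_iff)
  then have "finite (supp M)" by (rule finite_subset) simp
  from the1_equality[OF listing_ex1[OF this]] show ?thesis
    unfolding listing_def using assms by blast
qed

lemma listing:
  assumes "finite (supp M)"
  shows "sorted_wrt (pair_le d) (listing d M)" "count_list (listing d M) (i, j) = M i j"
  using theI'[OF listing_ex1[OF assms, of d]] unfolding listing_def by blast+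

lemma u_mat_madd:
  assumes M: "M \<in> mats C1 d D dD" and N: "N \<in> mats C2 d D dD"
    and less: "\<And>a b. a \<in> C1 \<Longrightarrow> b \<in> C2 \<Longrightarrow> a < b"
  shows "u_mat g d (madd M N) = u_mat g d M * u_mat g d N"
proof -
  note fin = mats_finite[OF M] mats_finite[OF N]
  have rows: "fst p \<in> C" if "L \<in> mats C d D dD" "p \<in> set (listing d L)" for L C p
    using that listing(2)[OF mats_finite[OF that(1)], of d "fst p" "snd p"] mats_outside[OF that(1)]
    by (metis count_list_0_iff mem_Sigma_iff prod.collapse)
  have "listing d (madd M N) = listing d M @ listing d N"
  proof (rule listing_eqI)
    have "pair_le d p q" if "p \<in> set (listing d M)" "q \<in> set (listing d N)" for p q
      using less[OF rows[OF M that(1)] rows[OF N that(2)]]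
      by (cases p; cases q) (simp add: pair_le_def)
    then show "sorted_wrt (pair_le d) (listing d M @ listing d N)"
      by (simp add: sorted_wrt_append listing fin)
  qed (simp add: listing fin madd_def)
  then show ?thesis by (simp add: u_mat_def)
qed

lemma u_mat_zero:
  fixes d :: "'c::linorder \<Rightarrow> bit" and g :: "'d::linorder \<Rightarrow> U_alg"
  shows "u_mat g d (\<lambda>_ _. 0) = 1"
proof -
  have "listing d (\<lambda>(_::'c) (_::'d). 0) = []" by (rule listing_eqI) simp_all
  then show ?thesis by (simp add: u_mat_def)
qed

definition row_mat :: "'c \<Rightarrow> 'd list \<Rightarrow> 'c \<Rightarrow> 'd \<Rightarrow> nat"
  where "row_mat c ds = (\<lambda>i j. if i = c then count_list ds j else 0)"

lemma supp_row_mat: "supp (row_mat c ds) = {c} \<times> set ds"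
  by (auto simp: supp_def row_mat_def count_list_0_iff simp del: neq0_conv)

lemma wt_row_row_mat: "wt_row (row_mat c ds) = frag_cmul (int (length ds)) (frag_of c)"
proof -
  have "wt_row (row_mat c ds) = (\<Sum>j\<in>set ds. frag_cmul (int (count_list ds j)) (frag_of c))"
    unfolding wt_row_def supp_row_mat
    by (subst sum.Sigma[symmetric]) (simp_all add: row_mat_def)
  also have "\<dots> = frag_cmul (int (\<Sum>j\<in>set ds. count_list ds j)) (frag_of c)"
    by (rule poly_mapping_eqI) (simp add: lookup_sum sum_distrib_right)
  also have "(\<Sum>j\<in>set ds. count_list ds j) = length ds"
    by (rule sum_count_set) simp_all
  finally show ?thesis .
qed

lemma count_list_map_Pair: "count_list (map (Pair c) ds) (i, j) = row_mat c ds i j"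
  by (induction ds) (auto simp: row_mat_def)

lemma bit_nonzero: "x \<noteq> (0::bit) \<longleftrightarrow> x = 1"
  by (cases x) auto

text \<open>
  This translates the bound on the entries of an odd row into strictness of its word: \<^const>\<open>pair_le\<close>
  by itself allows repetitions.
\<close>

lemma distinct_iff_count_list: "distinct ds \<longleftrightarrow> (\<forall>j. count_list ds j \<le> 1)"
proof (induction ds)
  case (Cons a ds)
  have "distinct (a # ds) \<longleftrightarrow> count_list ds a = 0 \<and> (\<forall>j. count_list ds j \<le> 1)"
    using Cons by (simp add: count_list_0_iff)
  also have "\<dots> \<longleftrightarrow> (\<forall>j. count_list (a # ds) j \<le> 1)"
  proof
    assume *: "\<forall>j. count_list (a # ds) j \<le> 1"
    then show "count_list ds a = 0 \<and> (\<forall>j. count_list ds j \<le> 1)"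
      using spec[OF *, of a] by (force split: if_splits)
  qed auto
  finally show ?case .
qed simp

lemma row_mat_word:
  fixes ds :: "'d::linorder list"
  assumes "sorted_wrt (\<lambda>j l. (l \<le> j) = (d c = 0)) ds"
  shows "row_mat c ds \<in> mats {c} d UNIV (\<lambda>_. 0)" "listing d (row_mat c ds) = map (Pair c) ds"
    "u_mat g d (row_mat c ds) = prod_list (map g ds)"
proof -
  have "distinct ds" if "d c \<noteq> 0"
    using assms that by (simp add: not_le strict_sorted_iff)
  then show "row_mat c ds \<in> mats {c} d UNIV (\<lambda>_. 0)"
    by (auto simp: mats_def supp_row_mat) (auto simp: row_mat_def distinct_iff_count_list)
  show l: "listing d (row_mat c ds) = map (Pair c) ds"
    using assms
    by (intro listing_eqI count_list_map_Pair)
      (auto simp: sorted_wrt_map pair_le_def bit_nonzero le_less not_le elim!: sorted_wrt_mono_rel[rotated])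
  then show "u_mat g d (row_mat c ds) = prod_list (map g ds)"
    by (simp add: u_mat_def comp_def)
qed

lemma listing_single_row:
  fixes M :: "'c::linorder \<Rightarrow> 'd::linorder \<Rightarrow> nat"
  assumes M: "M \<in> mats {c} d UNIV (\<lambda>_. 0)"
  defines "ds \<equiv> map snd (listing d M)"
  shows "sorted_wrt (\<lambda>j l. (l \<le> j) = (d c = 0)) ds" "row_mat c ds = M"
proof -
  note l = listing[OF mats_finite[OF M], of d]
  have "fst p = c" if "p \<in> set (listing d M)" for p
    using that l(2)[of "fst p" "snd p"] mats_outside[OF M, of "fst p" "snd p"]
    by (metis count_list_0_iff mem_Sigma_iff prod.collapse singletonD)
  then have ps: "listing d M = map (Pair c) ds"
    unfolding ds_def by (simp add: map_idI comp_def) (metis map_idI prod.collapse)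
  show "row_mat c ds = M"
    using l(2) by (simp add: ps count_list_map_Pair fun_eq_iff)
  have "distinct ds" if "d c \<noteq> 0"
    unfolding distinct_iff_count_list
  proof
    fix j
    have "count_list ds j = M c j" using fun_cong[OF fun_cong[OF \<open>row_mat c ds = M\<close>], of c j]
      by (simp add: row_mat_def)
    with M that show "count_list ds j \<le> 1" by (auto simp: mats_def)
  qed
  moreover have "sorted_wrt (\<lambda>j l. pair_le d (c, j) (c, l)) ds"
    using l(1) by (simp add: ps sorted_wrt_map)
  ultimately show "sorted_wrt (\<lambda>j l. (l \<le> j) = (d c = 0)) ds"
  proof (cases "d c = 0")
    case True
    then show ?thesis
      using \<open>sorted_wrt (\<lambda>j l. pair_le d (c, j) (c, l)) ds\<close>
      by (elim sorted_wrt_mono_rel[rotated]) (auto simp: pair_le_def)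
  next
    case False
    then have "sorted_wrt (\<lambda>j l. pair_le d (c, j) (c, l) \<and> j \<noteq> l) ds"
      using \<open>sorted_wrt (\<lambda>j l. pair_le d (c, j) (c, l)) ds\<close> \<open>d c \<noteq> 0 \<Longrightarrow> distinct ds\<close>
      by (simp add: sorted_wrt_iff_nth_less distinct_conv_nth)
    with False show ?thesis
      by (elim sorted_wrt_mono_rel[rotated]) (auto simp: pair_le_def)
  qed
qed

section \<open>Exchange for finitely many rows\<close>

definition fam_map :: "('l \<Rightarrow> 'm) \<Rightarrow> ('i, 'l) fam \<Rightarrow> ('i, 'm) fam"
  where "fam_map \<phi> F = (fst F, \<lambda>i. \<phi> (snd F i))"

lemma fam_map_cong: "F \<approx> G \<Longrightarrow> fam_map \<phi> F \<approx> fam_map \<phi> G"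
  unfolding fam_eq_def fam_map_def by auto

lemma fam_map_mult:
  assumes "\<And>x y. \<phi> (x * y) = \<phi> x * \<phi> y"
  shows "fam_map \<phi> (F \<otimes> G) = fam_map \<phi> F \<otimes> fam_map \<phi> G"
  unfolding fam_map_def fam_mult_def by (auto simp: assms)

text \<open>
  For a single row \<open>a\<close> and a single dual row \<open>b\<close> the weights are multiples of \<open>\<epsilon>\<^sub>a\<close> and
  \<open>\<epsilon>\<^sub>b\<close>, and were recorded as numbers so far.
\<close>

fun weigh :: "'a \<Rightarrow> 'b \<Rightarrow> (nat, nat) label \<Rightarrow> ('a \<Rightarrow>\<^sub>0 int, 'b \<Rightarrow>\<^sub>0 int) label"
  where "weigh a b (Label m n x) =
    Label (frag_cmul (int m) (frag_of a)) (frag_cmul (int n) (frag_of b)) x"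

lemma weigh_mult: "weigh a b (x * y) = weigh a b x * weigh a b y"
  by (cases x; cases y) (simp add: frag_cmul_distrib)

definition A_lab :: "('a::linorder \<Rightarrow> bit) \<Rightarrow> ('a \<Rightarrow> num \<Rightarrow> nat) \<Rightarrow> ('a \<Rightarrow>\<^sub>0 int, 'b \<Rightarrow>\<^sub>0 int) label"
  where "A_lab dA X = Label (wt_row X) 0 (u_mat u_gen dA X)"

definition B_lab :: "('b::linorder \<Rightarrow> bit) \<Rightarrow> ('b \<Rightarrow> num dual \<Rightarrow> nat) \<Rightarrow> ('a \<Rightarrow>\<^sub>0 int, 'b \<Rightarrow>\<^sub>0 int) label"
  where "B_lab dB Y = Label 0 (wt_row Y) (u_mat uv_gen dB Y)"

definition Z_lab :: "('a \<Rightarrow> 'b \<Rightarrow> nat) \<Rightarrow> ('a \<Rightarrow>\<^sub>0 int, 'b \<Rightarrow>\<^sub>0 int) label"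
  where "Z_lab Z = Label (wt_row Z) (wt_col Z) (V 0 ^ msize Z)"

definition A_fam :: "('a::linorder \<Rightarrow> bit) \<Rightarrow> 'a set \<Rightarrow> ('a \<Rightarrow> num \<Rightarrow> nat, ('a \<Rightarrow>\<^sub>0 int, 'b \<Rightarrow>\<^sub>0 int) label) fam"
  where "A_fam dA S = (mats S dA UNIV (\<lambda>_. 0), A_lab dA)"

definition B_fam :: "('b::linorder \<Rightarrow> bit) \<Rightarrow> 'b set \<Rightarrow> ('b \<Rightarrow> num dual \<Rightarrow> nat, ('a \<Rightarrow>\<^sub>0 int, 'b \<Rightarrow>\<^sub>0 int) label) fam"
  where "B_fam dB T = (mats T dB UNIV (\<lambda>_. 0), B_lab dB)"

definition Z_fam :: "('a \<Rightarrow> bit) \<Rightarrow> ('b \<Rightarrow> bit) \<Rightarrow> 'a set \<Rightarrow> 'b set \<Rightarrow>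
    ('a \<Rightarrow> 'b \<Rightarrow> nat, ('a \<Rightarrow>\<^sub>0 int, 'b \<Rightarrow>\<^sub>0 int) label) fam"
  where "Z_fam dA dB S T = (mats S dA T dB, Z_lab)"

lemma Z_lab_madd: "finite (supp M) \<Longrightarrow> finite (supp N) \<Longrightarrow> Z_lab (madd M N) = Z_lab M * Z_lab N"
  by (simp add: Z_lab_def wt_row_madd wt_col_madd msize_madd power_add)

lemma Z_fam_central: "fam_central (Z_fam dA dB S T)"
  unfolding fam_central_def
proof (intro ballI allI)
  fix Z l
  show "snd (Z_fam dA dB S T) Z * l = l * snd (Z_fam dA dB S T) Z"
    by (cases l) (simp add: Z_fam_def Z_lab_def V_0_power_central add.commute)
qed

lemma A_fam_split:
  fixes dA :: "'a::linorder \<Rightarrow> bit"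
  assumes "\<And>a b. a \<in> S1 \<Longrightarrow> b \<in> S2 \<Longrightarrow> a < b"
  shows "A_fam dA (S1 \<union> S2) \<approx> A_fam dA S1 \<otimes> A_fam dA S2"
  unfolding A_fam_def
proof (rule mats_fam_split)
  show "S1 \<times> UNIV \<inter> S2 \<times> UNIV = ({} :: ('a \<times> num) set)"
    using assms by (fastforce dest: assms)
  fix M N :: "'a \<Rightarrow> num \<Rightarrow> nat" assume "M \<in> mats S1 dA UNIV (\<lambda>_. 0 :: bit)" "N \<in> mats S2 dA UNIV (\<lambda>_. 0 :: bit)"
  then show "A_lab dA (madd M N) = A_lab dA M * A_lab dA N"
    using assms by (simp add: A_lab_def u_mat_madd wt_row_madd mats_finite)
qed auto

lemma B_fam_split:
  fixes dB :: "'b::linorder \<Rightarrow> bit"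
  assumes "\<And>a b. a \<in> S1 \<Longrightarrow> b \<in> S2 \<Longrightarrow> a < b"
  shows "B_fam dB (S1 \<union> S2) \<approx> B_fam dB S1 \<otimes> B_fam dB S2"
  unfolding B_fam_def
proof (rule mats_fam_split)
  show "S1 \<times> UNIV \<inter> S2 \<times> UNIV = ({} :: ('b \<times> num dual) set)"
    using assms by (fastforce dest: assms)
  fix M N :: "'b \<Rightarrow> num dual \<Rightarrow> nat" assume "M \<in> mats S1 dB UNIV (\<lambda>_. 0 :: bit)" "N \<in> mats S2 dB UNIV (\<lambda>_. 0 :: bit)"
  then show "B_lab dB (madd M N) = B_lab dB M * B_lab dB N"
    using assms by (simp add: B_lab_def u_mat_madd wt_row_madd mats_finite)
qed auto

lemma Z_fam_split_rows:
  "S1 \<inter> S2 = {} \<Longrightarrow> Z_fam dA dB (S1 \<union> S2) T \<approx> Z_fam dA dB S1 T \<otimes> Z_fam dA dB S2 T"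
  unfolding Z_fam_def by (rule mats_fam_split) (auto simp: Z_lab_madd mats_finite)

lemma Z_fam_split_cols:
  "T1 \<inter> T2 = {} \<Longrightarrow> Z_fam dA dB S (T1 \<union> T2) \<approx> Z_fam dA dB S T1 \<otimes> Z_fam dA dB S T2"
  unfolding Z_fam_def by (rule mats_fam_split) (auto simp: Z_lab_madd mats_finite)

lemma map_nat_of_num_word: "0 \<notin> set xs \<Longrightarrow> map nat_of_num (map num_of_nat xs) = xs"
  by (induction xs) (auto simp: num_of_nat_inverse)

lemma num_of_nat_le: "0 < m \<Longrightarrow> 0 < n \<Longrightarrow> num_of_nat m \<le> num_of_nat n \<longleftrightarrow> m \<le> n"
  by (simp add: less_eq_num_def num_of_nat_inverse)

lemma A_fam_single:
  "fam_map (weigh a b) (U_fam (dA a = 0)) \<approx> A_fam dA {a}"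
  unfolding fam_map_def U_fam_def A_fam_def fst_conv snd_conv
proof (rule fam_eqI)
  let ?h = "\<lambda>xs. row_mat a (map num_of_nat xs)"
  let ?k = "\<lambda>X. map nat_of_num (map snd (listing dA X))"
  fix xs assume "xs \<in> U_words (dA a = 0)"
  then have xs: "0 \<notin> set xs" "sorted_wrt (\<lambda>j l. (l \<le> j) = (dA a = 0)) xs"
    by (auto simp: U_words_def)
  have "sorted_wrt (\<lambda>j l. (l \<le> j) = (dA a = 0)) (map num_of_nat xs)"
    unfolding sorted_wrt_map using xs(2)
    by (rule sorted_wrt_mono_rel[rotated]) (use xs(1) num_of_nat_le in \<open>metis neq0_conv\<close>)
  note row = row_mat_word[where d = dA and c = a, OF this]
  have "Uw xs = prod_list (map u_gen (map num_of_nat xs))"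
    unfolding map_map by (rule arg_cong[of _ _ prod_list], rule map_cong)
      (use xs(1) in \<open>auto simp: U_def\<close>)
  then show "?h xs \<in> mats {a} dA UNIV (\<lambda>_. 0) \<and> ?k (?h xs) = xs \<and>
    A_lab dA (?h xs) = weigh a b (Label (length xs) 0 (Uw xs))"
    unfolding A_lab_def row(2,3) wt_row_row_mat
    using row(1) map_nat_of_num_word[OF xs(1)] by (simp add: comp_def)
next
  let ?h = "\<lambda>xs. row_mat a (map num_of_nat xs)"
  let ?k = "\<lambda>X. map nat_of_num (map snd (listing dA X))"
  fix X assume "X \<in> mats {a} dA (UNIV :: num set) (\<lambda>_. 0)"
  note row = listing_single_row[OF this]
  show "?k X \<in> U_words (dA a = 0) \<and> ?h (?k X) = X"
    using row by (auto simp: U_words_def nat_of_num_neq_0[symmetric] sorted_wrt_map less_eq_num_def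
      nat_of_num_inverse comp_def)
qed

lemma B_fam_single:
  "fam_map (weigh a b) (V_fam (dB b = 0)) \<approx> B_fam dB {b}"
  unfolding fam_map_def V_fam_def B_fam_def fst_conv snd_conv
proof (rule fam_eqI)
  let ?h = "\<lambda>ys. row_mat b (map dual (map num_of_nat ys))"
  let ?k = "\<lambda>Y. map nat_of_num (map undual (map snd (listing dB Y)))"
  fix ys assume "ys \<in> V_words (dB b = 0)"
  then have ys: "0 \<notin> set ys" "sorted_wrt (\<lambda>j l. (j \<le> l) = (dB b = 0)) ys"
    by (auto simp: V_words_def)
  have "sorted_wrt (\<lambda>j l. (l \<le> j) = (dB b = 0)) (map dual (map num_of_nat ys))"
    unfolding sorted_wrt_map using ys(2)
    by (rule sorted_wrt_mono_rel[rotated])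
      (use ys(1) num_of_nat_le in \<open>metis neq0_conv less_eq_dual_iff undual_dual\<close>)
  note row = row_mat_word[where d = dB and c = b, OF this]
  have "Vw ys = prod_list (map uv_gen (map dual (map num_of_nat ys)))"
    unfolding map_map by (rule arg_cong[of _ _ prod_list], rule map_cong)
      (use ys(1) in \<open>auto simp: V_def\<close>)
  then show "?h ys \<in> mats {b} dB UNIV (\<lambda>_. 0) \<and> ?k (?h ys) = ys \<and>
    B_lab dB (?h ys) = weigh a b (Label 0 (length ys) (Vw ys))"
    unfolding B_lab_def row(2,3) wt_row_row_mat
    using row(1) map_nat_of_num_word[OF ys(1)] by (simp add: comp_def)
next
  let ?h = "\<lambda>ys. row_mat b (map dual (map num_of_nat ys))"
  let ?k = "\<lambda>Y. map nat_of_num (map undual (map snd (listing dB Y)))"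
  fix Y assume "Y \<in> mats {b} dB (UNIV :: num dual set) (\<lambda>_. 0)"
  note row = listing_single_row[OF this]
  show "?k Y \<in> V_words (dB b = 0) \<and> ?h (?k Y) = Y"
    using row by (auto simp: V_words_def nat_of_num_neq_0[symmetric] sorted_wrt_map less_eq_num_def
      nat_of_num_inverse comp_def less_eq_dual_def)
qed

lemma Z_fam_single:
  "fam_map (weigh a b) (t_fam ((dA a = 0) \<noteq> (dB b = 0))) \<approx> Z_fam dA dB {a} {b}"
  unfolding fam_map_def t_fam_def Z_fam_def fst_conv snd_conv
proof (rule fam_eqI)
  let ?h = "\<lambda>z i j. if i = a \<and> j = b then z else (0::nat)"
  have bits: "(dA a = 0) \<noteq> (dB b = 0) \<longleftrightarrow> dA a \<noteq> dB b"
    by (metis bit_nonzero)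
  {
    fix z :: nat assume z: "z \<in> {z. (dA a = 0) \<noteq> (dB b = 0) \<longrightarrow> z \<le> 1}"
    have supp: "supp (?h z) = (if z = 0 then {} else {(a, b)})"
      by (auto simp: supp_def)
    have "?h z \<in> mats {a} dA {b} dB"
      using z by (auto simp: mats_def supp bits)
    moreover have "Z_lab (?h z) = weigh a b (Label z z (V 0 ^ z))"
      unfolding Z_lab_def wt_row_def wt_col_def msize_def supp by simp
    ultimately show "?h z \<in> mats {a} dA {b} dB \<and> ?h z a b = z \<and>
        Z_lab (?h z) = weigh a b (Label z z (V 0 ^ z))" by simp
  next
    fix Z assume Z: "Z \<in> mats {a} dA {b} dB"
    then have "Z a b \<in> {z. (dA a = 0) \<noteq> (dB b = 0) \<longrightarrow> z \<le> 1}"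
      unfolding bits by (auto simp: mats_def)
    moreover have "?h (Z a b) = Z"
      using mats_outside[OF Z] by (auto simp: fun_eq_iff)
    ultimately show "Z a b \<in> {z. (dA a = 0) \<noteq> (dB b = 0) \<longrightarrow> z \<le> 1} \<and> ?h (Z a b) = Z"
      by blast
  }
qed

lemma exchange_single:
  "A_fam dA {a} \<otimes> B_fam dB {b} \<approx> B_fam dB {b} \<otimes> A_fam dA {a} \<otimes> Z_fam dA dB {a} {b}"
proof -
  let ?w = "fam_map (weigh a b)"
  let ?U = "U_fam (dA a = 0)" and ?V = "V_fam (dB b = 0)" and ?t = "t_fam ((dA a = 0) \<noteq> (dB b = 0))"
  note mult = fam_map_mult[of "weigh a b", OF weigh_mult]
  have "A_fam dA {a} \<otimes> B_fam dB {b} \<approx> ?w ?U \<otimes> ?w ?V"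
    by (intro fam_mult_cong fam_eq_sym[OF A_fam_single] fam_eq_sym[OF B_fam_single])
  also have "?w ?U \<otimes> ?w ?V \<approx> ?w ?V \<otimes> ?w ?U \<otimes> ?w ?t"
    using fam_map_cong[OF word_exchange, of "weigh a b"] by (simp only: mult)
  also have "\<dots> \<approx> B_fam dB {b} \<otimes> A_fam dA {a} \<otimes> Z_fam dA dB {a} {b}"
    by (intro fam_mult_cong A_fam_single B_fam_single Z_fam_single)
  finally show ?thesis .
qed

lemma mats_empty: "mats {} dC D dD = {\<lambda>_ _. 0}" "mats C dC {} dD = {\<lambda>_ _. 0}"
  by (auto simp: mats_def supp_def fun_eq_iff)

lemma supp_zero: "supp (\<lambda>_ _. 0) = {}"
  by (simp add: supp_def)

lemma label_one: "Label 0 0 1 * l = l" "l * Label 0 0 1 = l"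
  by (cases l; simp)+

lemma zero_labels:
  "A_lab dA (\<lambda>_ _. 0) = Label 0 0 1" "B_lab dB (\<lambda>_ _. 0) = Label 0 0 1" "Z_lab (\<lambda>_ _. 0) = Label 0 0 1"
  by (simp_all add: A_lab_def B_lab_def Z_lab_def wt_row_def wt_col_def msize_def supp_zero u_mat_zero)

lemma exchange_no_rows:
  "A_fam dA {} \<otimes> B_fam dB T \<approx> B_fam dB T \<otimes> A_fam dA {} \<otimes> Z_fam dA dB {} T"
  unfolding A_fam_def B_fam_def Z_fam_def fam_mult_def fst_conv snd_conv mats_empty
  by (rule fam_eqI[where h = "\<lambda>(X, Y). (Y, X, \<lambda>_ _. 0)" and k = "\<lambda>(Y, X, Z). (X, Y)"])
    (auto simp: zero_labels label_one)

lemma exchange_no_cols: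
  "A_fam dA S \<otimes> B_fam dB {} \<approx> B_fam dB {} \<otimes> A_fam dA S \<otimes> Z_fam dA dB S {}"
  unfolding A_fam_def B_fam_def Z_fam_def fam_mult_def fst_conv snd_conv mats_empty
  by (rule fam_eqI[where h = "\<lambda>(X, Y). (Y, X, \<lambda>_ _. 0)" and k = "\<lambda>(Y, X, Z). (X, Y)"])
    (auto simp: zero_labels label_one)

text \<open>
  Rows are split off at the upper end of \<open>S\<close> and of \<open>T\<close>, because the word of a matrix lists its rows
  in increasing order.
\<close>

lemma exchange_finite:
  assumes "finite S" "finite T"
  shows "A_fam dA S \<otimes> B_fam dB T \<approx> B_fam dB T \<otimes> A_fam dA S \<otimes> Z_fam dA dB S T"
  using assms(1)
proof (induction S rule: finite_linorder_max_induct)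
  case empty
  show ?case by (rule exchange_no_rows)
next
  case (insert a S)
  have row: "A_fam dA {a} \<otimes> B_fam dB T \<approx> B_fam dB T \<otimes> A_fam dA {a} \<otimes> Z_fam dA dB {a} T"
    using assms(2)
  proof (induction T rule: finite_linorder_max_induct)
    case empty
    show ?case by (rule exchange_no_cols)
  next
    case (insert b T)
    have T: "insert b T = T \<union> {b}" by simp
    show ?case
      unfolding T
    proof (rule exchange_mult_right)
      show "B_fam dB (T \<union> {b}) \<approx> B_fam dB T \<otimes> B_fam dB {b}"
        using insert(2) by (intro B_fam_split) auto
      show "Z_fam dA dB {a} (T \<union> {b}) \<approx> Z_fam dA dB {a} T \<otimes> Z_fam dA dB {a} {b}"
        using insert(2) by (intro Z_fam_split_cols) auto
    qed (rule Z_fam_central insert.IH exchange_single)+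
  qed
  have S: "insert a S = S \<union> {a}" by simp
  show ?case
    unfolding S
  proof (rule exchange_mult_left)
    show "A_fam dA (S \<union> {a}) \<approx> A_fam dA S \<otimes> A_fam dA {a}"
      using insert(2) by (intro A_fam_split) auto
    show "Z_fam dA dB (S \<union> {a}) T \<approx> Z_fam dA dB S T \<otimes> Z_fam dA dB {a} T"
      using insert(2) by (intro Z_fam_split_rows) auto
  qed (rule Z_fam_central insert.IH row)+
qed

section \<open>Arbitrary index sets\<close>

lemma lookup_wt_nonneg: "0 \<le> Poly_Mapping.lookup (wt_row M) i" "0 \<le> Poly_Mapping.lookup (wt_col M) j"
  unfolding wt_row_def wt_col_def lookup_sum by (auto intro!: sum_nonneg)

text \<open>
  Entries are nonnegative, so nothing cancels in a weight: it detects every row with a nonzero entry.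
\<close>

lemma keys_wt_row:
  assumes "finite (supp M)" "M i j \<noteq> 0"
  shows "i \<in> Poly_Mapping.keys (wt_row M)"
proof -
  have "0 < Poly_Mapping.lookup (wt_row M) i"
    unfolding wt_row_def lookup_sum
    by (rule sum_pos2[where i = "(i, j)"]) (use assms in \<open>auto simp: supp_def\<close>)
  then show ?thesis by (simp add: in_keys_iff)
qed

lemma keys_wt_col:
  assumes "finite (supp M)" "M i j \<noteq> 0"
  shows "j \<in> Poly_Mapping.keys (wt_col M)"
proof -
  have "0 < Poly_Mapping.lookup (wt_col M) j"
    unfolding wt_col_def lookup_sum
    by (rule sum_pos2[where i = "(i, j)"]) (use assms in \<open>auto simp: supp_def\<close>)
  then show ?thesis by (simp add: in_keys_iff)
qed

lemma keys_add_nonneg: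
  fixes v w :: "'k \<Rightarrow>\<^sub>0 int"
  assumes "\<And>i. 0 \<le> Poly_Mapping.lookup v i" "\<And>i. 0 \<le> Poly_Mapping.lookup w i"
  shows "Poly_Mapping.keys (v + w) = Poly_Mapping.keys v \<union> Poly_Mapping.keys w"
  using assms by (auto simp: in_keys_iff lookup_add add_nonneg_eq_0_iff)

fun label_support :: "'a set \<Rightarrow> 'b set \<Rightarrow> ('a \<Rightarrow>\<^sub>0 int, 'b \<Rightarrow>\<^sub>0 int) label \<Rightarrow> 'a set \<times> 'b set"
  where "label_support A B (Label v w x) = (A \<inter> Poly_Mapping.keys v, B \<inter> Poly_Mapping.keys w)"

lemma mats_shrink:
  assumes M: "M \<in> mats C dC D dD"
    and "\<And>i j. M i j \<noteq> 0 \<Longrightarrow> i \<in> C \<Longrightarrow> j \<in> D \<Longrightarrow> i \<in> C' \<and> j \<in> D'"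
    and "C' \<subseteq> C" "D' \<subseteq> D"
  shows "M \<in> mats C' dC D' dD"
proof -
  have "(i, j) \<in> C' \<times> D'" if "(i, j) \<in> supp M" for i j
    using that assms(2)[of i j] mats_outside[OF M, of i j] by (auto simp: supp_def)
  then have "supp M \<subseteq> C' \<times> D'" by auto
  moreover have "M i j \<le> 1" if "i \<in> C'" "j \<in> D'" "dC i \<noteq> dD j" for i j
    using M that subsetD[OF assms(3)] subsetD[OF assms(4)] by (simp add: mats_def)
  ultimately show ?thesis
    using M by (simp add: mats_def)
qed

text \<open>
  The supports of the two weights are finite sets \<open>S\<close> and \<open>T\<close>, and they are the same on both sides
  of a label-preserving bijection. All matrices with these weights live on the rows in \<open>S\<close> and \<open>T\<close>,
  where the finite case applies.
\<close>

lemma exchange_all: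
  "A_fam dA A \<otimes> B_fam dB B \<approx> B_fam dB B \<otimes> A_fam dA A \<otimes> Z_fam dA dB A B"
  unfolding A_fam_def B_fam_def Z_fam_def fam_mult_def fst_conv snd_conv
proof (rule fam_eq_glue[where \<kappa> = "label_support A B" and
      K = "{(S, T). finite S \<and> finite T \<and> S \<subseteq> A \<and> T \<subseteq> B}" and
      I' = "\<lambda>(S, T). mats S dA UNIV (\<lambda>_. 0) \<times> mats T dB UNIV (\<lambda>_. 0)" and
      J' = "\<lambda>(S, T). mats T dB UNIV (\<lambda>_. 0) \<times> mats S dA UNIV (\<lambda>_. 0) \<times> mats S dA T dB"], goal_cases)
  case (1 k)
  then obtain S T where k: "k = (S, T)" "finite S" "finite T" by auto
  show ?case
    using exchange_finite[OF k(2,3), of dA dB]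
    by (simp add: k(1) A_fam_def B_fam_def Z_fam_def fam_mult_def)
next
  case (2 i)
  obtain X Y where i: "i = (X, Y)" by (cases i)
  have X: "X \<in> mats A dA UNIV (\<lambda>_. 0)" and Y: "Y \<in> mats B dB UNIV (\<lambda>_. 0)"
    using 2 by (simp_all add: i)
  have "X \<in> mats (A \<inter> Poly_Mapping.keys (wt_row X)) dA UNIV (\<lambda>_. 0)"
    using keys_wt_row[OF mats_finite[OF X]] by (intro mats_shrink[OF X]) auto
  moreover have "Y \<in> mats (B \<inter> Poly_Mapping.keys (wt_row Y)) dB UNIV (\<lambda>_. 0)"
    using keys_wt_row[OF mats_finite[OF Y]] by (intro mats_shrink[OF Y]) auto
  ultimately show ?case by (simp add: i A_lab_def B_lab_def)
next
  case (3 j)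
  obtain Y X Z where j: "j = (Y, X, Z)" by (metis prod_cases3)
  have X: "X \<in> mats A dA UNIV (\<lambda>_. 0)" and Y: "Y \<in> mats B dB UNIV (\<lambda>_. 0)"
    and Z: "Z \<in> mats A dA B dB"
    using 3 by (simp_all add: j)
  let ?S = "A \<inter> Poly_Mapping.keys (wt_row X + wt_row Z)"
  let ?T = "B \<inter> Poly_Mapping.keys (wt_row Y + wt_col Z)"
  have "X \<in> mats ?S dA UNIV (\<lambda>_. 0)"
    using keys_wt_row[OF mats_finite[OF X]]
    by (intro mats_shrink[OF X]) (auto simp: keys_add_nonneg lookup_wt_nonneg)
  moreover have "Y \<in> mats ?T dB UNIV (\<lambda>_. 0)"
    using keys_wt_row[OF mats_finite[OF Y]]
    by (intro mats_shrink[OF Y]) (auto simp: keys_add_nonneg lookup_wt_nonneg)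
  moreover have "Z \<in> mats ?S dA ?T dB"
    using keys_wt_row[OF mats_finite[OF Z]] keys_wt_col[OF mats_finite[OF Z]]
    by (intro mats_shrink[OF Z]) (auto simp: keys_add_nonneg lookup_wt_nonneg)
  ultimately show ?case by (simp add: j A_lab_def B_lab_def Z_lab_def)
next
  case (4 k)
  then obtain S T where "k = (S, T)" "S \<subseteq> A" "T \<subseteq> B" by auto
  then show ?case by (simp add: Sigma_mono mats_mono)
next
  case (5 k)
  then obtain S T where "k = (S, T)" "S \<subseteq> A" "T \<subseteq> B" by auto
  then show ?case by (simp add: Sigma_mono mats_mono)
qed

lemma V_0_power: "V 0 ^ n = scaleU (tvar ^ n) 1"
proof -
  interpret module scaleU by (rule module_scaleU)
  show ?thesis by (induction n) (simp_all add: V_def scaleU_mult_left)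
qed

theorem theorem5p1:
  fixes A :: "'a::linorder set" and dA :: "'a \<Rightarrow> bit"
    and B :: "'b::linorder set" and dB :: "'b \<Rightarrow> bit"
  assumes "countable A" and "countable B"
  shows "\<exists>\<Phi> :: ('a \<Rightarrow> num \<Rightarrow> nat) \<times> ('b \<Rightarrow> num dual \<Rightarrow> nat)
                \<Rightarrow> ('b \<Rightarrow> num dual \<Rightarrow> nat) \<times> ('a \<Rightarrow> num \<Rightarrow> nat) \<times> ('a \<Rightarrow> 'b \<Rightarrow> nat).
    bij_betw \<Phi>
      (mats A dA UNIV (\<lambda>_. 0) \<times> mats B dB UNIV (\<lambda>_. 0))
      (mats B dB UNIV (\<lambda>_. 0) \<times> mats A dA UNIV (\<lambda>_. 0) \<times> mats A dA B dB) \<and>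
    (\<forall>X \<in> mats A dA UNIV (\<lambda>_. 0). \<forall>Y \<in> mats B dB UNIV (\<lambda>_. 0). \<forall>Y' X' Z.
      \<Phi> (X, Y) = (Y', X', Z) \<longrightarrow>
        wt_row X = wt_row X' + wt_row Z \<and>
        wt_row Y = wt_row Y' + wt_col Z \<and>
        u_mat u_gen dA X * u_mat uv_gen dB Y =
          scaleU (tvar ^ msize Z) (u_mat uv_gen dB Y' * u_mat u_gen dA X'))"
proof -
  obtain \<Phi> where bij: "bij_betw \<Phi>
      (mats A dA UNIV (\<lambda>_. 0) \<times> mats B dB UNIV (\<lambda>_. 0))
      (mats B dB UNIV (\<lambda>_. 0) \<times> mats A dA UNIV (\<lambda>_. 0) \<times> mats A dA B dB)"
    and lab: "\<forall>p \<in> mats A dA UNIV (\<lambda>_. 0) \<times> mats B dB UNIV (\<lambda>_. 0).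
      (\<lambda>(Y', p). B_lab dB Y' * (\<lambda>(X', Z). A_lab dA X' * Z_lab Z) p) (\<Phi> p) =
      (\<lambda>(X, Y). A_lab dA X * B_lab dB Y) p"
    using exchange_all[of dA A dB B]
    unfolding fam_eq_def A_fam_def B_fam_def Z_fam_def fam_mult_def fst_conv snd_conv by metis
  have "wt_row X = wt_row X' + wt_row Z \<and> wt_row Y = wt_row Y' + wt_col Z \<and>
      u_mat u_gen dA X * u_mat uv_gen dB Y =
        scaleU (tvar ^ msize Z) (u_mat uv_gen dB Y' * u_mat u_gen dA X')"
    if "X \<in> mats A dA UNIV (\<lambda>_. 0)" "Y \<in> mats B dB UNIV (\<lambda>_. 0)" "\<Phi> (X, Y) = (Y', X', Z)"
    for X Y Y' X' Z
    using bspec[OF lab, of "(X, Y)"] that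
    by (simp add: A_lab_def B_lab_def Z_lab_def V_0_power scaleU_mult_right)
  with bij show ?thesis by blast
qed

end
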